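(* Let $\mathfrak{A}$ be a model of Presburger Arithmetic $\mathrm{PrA}$ that is one-dimensionally interpreted in the structure $(\mathbb{N},+)$ via a one-dimensional interpretation $\iota$. Then (a) $\mathfrak{A}$ is isomorphic to $(\mathbb{N},+)$; and (b) the isomorphism is definable in $(\mathbb{N},+)$, i.e. $\iota$ is definably isomorphic to the trivial (identity) one-dimensional interpretation of $(\mathbb{N},+)$ in $(\mathbb{N},+)$.
   Context: Presburger Arithmetic $\mathrm{PrA}$ is the first-order theory of $(\mathbb{N},+)$ (signature $\{=,+\}$). "Definable" means first-order definable without parameters in $(\mathbb{N},+)$. An $m$-dimensional translation $\iota$ from a signature $\Omega_1$ to a signature $\Omega_2$ consists of $\Omega_2$-formulas $\mathit{Dom}_\iota(\bar y)$ (with $\bar y$ an $m$-tuple of variables), $\mathit{Pred}_{\iota,P}(\bar y_1,\dots,\bar y_n)$ for each $n$-ary predicate $P$ of $\Omega_1$ (including equality), and $\mathit{Fun}_{\iota,f}(\bar y_0,\bar y_1,\dots,\bar y_n)$ for each $n$-ary function symbol $f$ of $\Omega_1$, each $\bar y_i$ an $m$-tuple. It is an interpretation of an $\Omega_1$-structure $\mathfrak{A}$ (domain $A$) in an $\Omega_2$-structure $\mathfrak{B}$ (domain $B$) if $\mathit{Dom}_\iota$ defines a nonempty $D\subseteq B^m$, $\mathit{Pred}_{\iota,=}$ defines an equivalence relation $\sim$ on $D$, and there is a bijection $h:D/{\sim}\to A$ such that for all $\bar b_i\in D$: $\mathfrak{A}\models P(h([\bar b_1]),\dots,h([\bar b_n]))$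 iff $\mathfrak{B}\models \mathit{Pred}_{\iota,P}(\bar b_1,\dots,\bar b_n)$, and $\mathfrak{A}\models h([\bar b_0])=f(h([\bar b_1]),\dots,h([\bar b_n]))$ iff $\mathfrak{B}\models\mathit{Fun}_{\iota,f}(\bar b_0,\dots,\bar b_n)$. A structure is $m$-dimensionally interpreted in $\mathfrak{B}$ if some $m$-dimensional translation is an interpretation of it in $\mathfrak{B}$. If $\iota_1,\iota_2$ are interpretations (of dimensions $m_1,m_2$, with domains $D_1,D_2$ and equivalences $\sim_1,\sim_2$) of the same structure $\mathfrak{A}$ in $\mathfrak{B}$, an $\Omega_2$-formula $I(\bar y,\bar z)$ ($\bar y$ of length $m_1$, $\bar z$ of length $m_2$) defines an isomorphism between them if the bijections $h_1,h_2$ can be chosen so that for all $\bar b\in D_1,\bar c\in D_2$: $h_1([\bar b]_{\sim_1})=h_2([\bar c]_{\sim_2})$ iff $\mathfrak{B}\models I(\bar b,\bar c)$; $\iota_1,\iota_2$ are definably isomorphic if such $I$ exists. The trivial interpretation of $(\mathbb{N},+)$ in itself is the one-dimensional one with domain formula $\top$, equality interpreted as equality and $+$ as $+$. *)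

theory Defs
  imports Main
begin

text \<open>
  First-order logic over the signature with equality and one binary function symbol \<open>+\<close>.
  Equality is a logical symbol: every structure interprets it as identity on its domain.
  The connectives and quantifiers not listed are definable from the listed ones.
\<close>

datatype tm = Var nat | Plus tm tm

datatype fm = Top | Eq tm tm | Neg fm | Conj fm fm | Ex nat fm

primrec tm_vars :: "tm \<Rightarrow> nat set" where
  "tm_vars (Var x) = {x}"
| "tm_vars (Plus t u) = tm_vars t \<union> tm_vars u"

primrec free_vars :: "fm \<Rightarrow> nat set" where
  "free_vars Top = {}"
| "free_vars (Eq t u) = tm_vars t \<union> tm_vars u"
| "free_vars (Neg \<phi>) = free_vars \<phi>"
| "free_vars (Conj \<phi> \<psi>) = free_vars \<phi> \<union> free_vars \<psi>"
| "free_vars (Ex x \<phi>) = free_vars \<phi> - {x}"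

record 'a plus_struct =
  elems :: "'a set"
  add :: "'a \<Rightarrow> 'a \<Rightarrow> 'a"

definition is_struct :: "'a plus_struct \<Rightarrow> bool" where
  "is_struct M \<longleftrightarrow> elems M \<noteq> {} \<and> (\<forall>x\<in>elems M. \<forall>y\<in>elems M. add M x y \<in> elems M)"

primrec tm_val :: "'a plus_struct \<Rightarrow> (nat \<Rightarrow> 'a) \<Rightarrow> tm \<Rightarrow> 'a" where
  "tm_val M s (Var x) = s x"
| "tm_val M s (Plus t u) = add M (tm_val M s t) (tm_val M s u)"

primrec sat :: "'a plus_struct \<Rightarrow> (nat \<Rightarrow> 'a) \<Rightarrow> fm \<Rightarrow> bool" where
  "sat M s Top \<longleftrightarrow> True"
| "sat M s (Eq t u) \<longleftrightarrow> tm_val M s t = tm_val M s u"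
| "sat M s (Neg \<phi>) \<longleftrightarrow> \<not> sat M s \<phi>"
| "sat M s (Conj \<phi> \<psi>) \<longleftrightarrow> sat M s \<phi> \<and> sat M s \<psi>"
| "sat M s (Ex x \<phi>) \<longleftrightarrow> (\<exists>a\<in>elems M. sat M (s(x := a)) \<phi>)"

definition valid_in :: "'a plus_struct \<Rightarrow> fm \<Rightarrow> bool" where
  "valid_in M \<phi> \<longleftrightarrow> (\<forall>s. range s \<subseteq> elems M \<longrightarrow> sat M s \<phi>)"

definition isomorphic :: "'a plus_struct \<Rightarrow> 'b plus_struct \<Rightarrow> bool" where
  "isomorphic M N \<longleftrightarrow> (\<exists>f. bij_betw f (elems M) (elems N) \<and>
     (\<forall>x\<in>elems M. \<forall>y\<in>elems M. f (add M x y) = add N (f x) (f y)))"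

definition nat_struct :: "nat plus_struct" where
  "nat_struct = \<lparr>elems = UNIV, add = (+)\<rparr>"

definition PrA :: "fm set" where
  "PrA = {\<phi>. free_vars \<phi> = {} \<and> valid_in nat_struct \<phi>}"

definition model_PrA :: "'a plus_struct \<Rightarrow> bool" where
  "model_PrA M \<longleftrightarrow> is_struct M \<and> (\<forall>\<phi>\<in>PrA. valid_in M \<phi>)"

text \<open>
  \<open>holds M \<phi> bs\<close> is the truth of \<open>\<phi>\<close> with variable \<open>i\<close> set to the \<open>i\<close>-th entry of \<open>bs\<close>.
  It is used only when all free variables of \<open>\<phi>\<close> are below \<open>length bs\<close>, so the unspecified
  values of \<open>bs ! i\<close> for \<open>i \<ge> length bs\<close> are irrelevant, and no parameters are involved.
\<close>

definition holds :: "'a plus_struct \<Rightarrow> fm \<Rightarrow> 'a list \<Rightarrow> bool" where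
  "holds M \<phi> bs \<longleftrightarrow> sat M (\<lambda>i. bs ! i) \<phi>"

text \<open>
  Translations of the signature into itself. A sequence of argument tuples of a formula is
  concatenated: with dimension \<open>m\<close>, component \<open>j\<close> of the \<open>i\<close>-th tuple is variable \<open>m * i + j\<close>.
  In \<open>tr_add\<close> the tuple standing for the value of the sum comes first.
\<close>

record translation =
  tr_dim :: nat
  tr_dom :: fm
  tr_eq :: fm
  tr_add :: fm

definition is_translation :: "translation \<Rightarrow> bool" where
  "is_translation \<iota> \<longleftrightarrow>
     free_vars (tr_dom \<iota>) \<subseteq> {..<tr_dim \<iota>} \<and>
     free_vars (tr_eq \<iota>) \<subseteq> {..<2 * tr_dim \<iota>} \<and>
     free_vars (tr_add \<iota>) \<subseteq> {..<3 * tr_dim \<iota>}"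

definition interp_dom :: "'b plus_struct \<Rightarrow> translation \<Rightarrow> 'b list set" where
  "interp_dom B \<iota> =
     {b. length b = tr_dim \<iota> \<and> set b \<subseteq> elems B \<and> holds B (tr_dom \<iota>) b}"

definition interp_rel :: "'b plus_struct \<Rightarrow> translation \<Rightarrow> ('b list \<times> 'b list) set" where
  "interp_rel B \<iota> =
     {(b, c). b \<in> interp_dom B \<iota> \<and> c \<in> interp_dom B \<iota> \<and> holds B (tr_eq \<iota>) (b @ c)}"

abbreviation interp_class :: "'b plus_struct \<Rightarrow> translation \<Rightarrow> 'b list \<Rightarrow> 'b list set" where
  "interp_class B \<iota> b \<equiv> interp_rel B \<iota> `` {b}"

definition interprets_via ::
  "'a plus_struct \<Rightarrow> 'b plus_struct \<Rightarrow> translation \<Rightarrow> ('b list set \<Rightarrow> 'a) \<Rightarrow> bool" where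
  "interprets_via A B \<iota> h \<longleftrightarrow>
     is_translation \<iota> \<and>
     interp_dom B \<iota> \<noteq> {} \<and>
     equiv (interp_dom B \<iota>) (interp_rel B \<iota>) \<and>
     bij_betw h (interp_dom B \<iota> // interp_rel B \<iota>) (elems A) \<and>
     (\<forall>b1\<in>interp_dom B \<iota>. \<forall>b2\<in>interp_dom B \<iota>.
        h (interp_class B \<iota> b1) = h (interp_class B \<iota> b2) \<longleftrightarrow>
        holds B (tr_eq \<iota>) (b1 @ b2)) \<and>
     (\<forall>b0\<in>interp_dom B \<iota>. \<forall>b1\<in>interp_dom B \<iota>. \<forall>b2\<in>interp_dom B \<iota>.
        h (interp_class B \<iota> b0) = add A (h (interp_class B \<iota> b1)) (h (interp_class B \<iota> b2)) \<longleftrightarrow>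
        holds B (tr_add \<iota>) (b0 @ b1 @ b2))"

definition is_interpretation :: "'a plus_struct \<Rightarrow> 'b plus_struct \<Rightarrow> translation \<Rightarrow> bool" where
  "is_interpretation A B \<iota> \<longleftrightarrow> (\<exists>h. interprets_via A B \<iota> h)"

definition definably_isomorphic ::
  "'a plus_struct \<Rightarrow> 'b plus_struct \<Rightarrow> translation \<Rightarrow> translation \<Rightarrow> bool" where
  "definably_isomorphic A B \<iota>1 \<iota>2 \<longleftrightarrow>
     (\<exists>I h1 h2.
        free_vars I \<subseteq> {..<tr_dim \<iota>1 + tr_dim \<iota>2} \<and>
        interprets_via A B \<iota>1 h1 \<and> interprets_via A B \<iota>2 h2 \<and>
        (\<forall>b\<in>interp_dom B \<iota>1. \<forall>c\<in>interp_dom B \<iota>2.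
           h1 (interp_class B \<iota>1 b) = h2 (interp_class B \<iota>2 c) \<longleftrightarrow> holds B I (b @ c)))"

definition trivial_translation :: translation where
  "trivial_translation =
     \<lparr>tr_dim = 1, tr_dom = Top, tr_eq = Eq (Var 0) (Var 1),
      tr_add = Eq (Var 0) (Plus (Var 1) (Var 2))\<rparr>"

lemma trivial_interpretation: "is_interpretation nat_struct nat_struct trivial_translation"
proof -
  let ?D = "interp_dom nat_struct trivial_translation"
  let ?r = "interp_rel nat_struct trivial_translation"
  have D: "?D = range (\<lambda>n. [n])"
    by (auto simp: interp_dom_def trivial_translation_def holds_def nat_struct_def length_Suc_conv)
  have r: "?r = {(b, b) | b. b \<in> ?D}"
    unfolding interp_rel_def
    by (auto simp: D) (auto simp: trivial_translation_def holds_def nat_struct_def)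
  have cls: "?r `` {[n]} = {[n]}" for n by (auto simp: r D)
  have quo: "?D // ?r = range (\<lambda>n. {[n]})"
    by (auto simp: quotient_def D cls)
  define h :: "nat list set \<Rightarrow> nat" where "h = (\<lambda>X. hd (the_elem X))"
  have h: "h {[n]} = n" for n by (simp add: h_def)
  have "interprets_via nat_struct nat_struct trivial_translation h"
    unfolding interprets_via_def
  proof (intro conjI)
    show "is_translation trivial_translation"
      by (auto simp: is_translation_def trivial_translation_def)
    show "?D \<noteq> {}" by (auto simp: D)
    show "equiv ?D ?r"
      by (rule equivI) (auto simp: r refl_on_def sym_def trans_def)
    have "bij_betw h (range (\<lambda>n. {[n]})) UNIV"
      by (auto simp: bij_betw_def inj_on_def h image_image)
    then show "bij_betw h (?D // ?r) (elems nat_struct)"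
      unfolding quo by (simp add: nat_struct_def)
  qed (auto simp: D cls h, auto simp: trivial_translation_def holds_def nat_struct_def)
  then show ?thesis by (auto simp: is_interpretation_def)
qed

end

theory Submission
  imports "HOL-Decision_Procs.Cooper" Defs
begin

text \<open>
  By quantifier elimination, a definable relation is eventually periodic in each variable, with a
  period that does not depend on the other variables and from a point on that is linear in them.
  If an interpreted model had an element \<open>a\<close> that is not a multiple of its unit, the intervals
  \<open>[k a, (k + 1) a)\<close> would be infinitely many disjoint infinite subsets of the naturals with a
  common eventual period, which is impossible. So the model is standard, and each code \<open>n\<close> stands
  for a natural number \<open>f n\<close>. The relation \<open>f (n + p) = f n + f w\<close> is definable, hence has in \<open>n\<close>
  a period \<open>N\<close> that works for all \<open>p\<close> and \<open>w\<close>, in particular for \<open>p = N\<close>. As \<open>f\<close> has at most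
  linear growth, along each residue class modulo \<open>N\<close> some increment \<open>f (n + N) - f n\<close> occurs
  infinitely often, hence, by periodicity, always from some point on. Thus the graph of \<open>f\<close> is a
  finite union of arithmetic progressions and so is definable.
\<close>

section \<open>Uniform eventual periodicity\<close>

primrec cooper_tm :: "(nat \<Rightarrow> nat) \<Rightarrow> tm \<Rightarrow> Cooper.num" where
  "cooper_tm e (Var x) = Cooper.Bound (e x)"
| "cooper_tm e (Plus t u) = Cooper.Add (cooper_tm e t) (cooper_tm e u)"

text \<open>Cooper's formulas range over the integers, so each quantifier is relativised to
  nonnegative values. \<open>e\<close> sends a named variable to its de Bruijn index: under a binder
  all indices move up by one and the bound name gets index 0.\<close>

primrec cooper_fm :: "(nat \<Rightarrow> nat) \<Rightarrow> Defs.fm \<Rightarrow> Cooper.fm" where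
  "cooper_fm e Top = Cooper.T"
| "cooper_fm e (Defs.Eq t u) = Cooper.Eq (Cooper.Sub (cooper_tm e t) (cooper_tm e u))"
| "cooper_fm e (Defs.Neg \<phi>) = Cooper.Not (cooper_fm e \<phi>)"
| "cooper_fm e (Conj \<phi> \<psi>) = Cooper.And (cooper_fm e \<phi>) (cooper_fm e \<psi>)"
| "cooper_fm e (Ex x \<phi>) =
     Cooper.E (Cooper.And (Cooper.Ge (Cooper.Bound 0)) (cooper_fm ((Suc \<circ> e)(x := 0)) \<phi>))"

lemma Inum_cooper_tm:
  assumes "\<forall>x\<in>tm_vars t. bs ! e x = int (s x)"
  shows "Inum bs (cooper_tm e t) = int (tm_val nat_struct s t)"
  using assms by (induction t) (auto simp: nat_struct_def)

lemma Ifm_cooper_fm: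
  assumes "\<forall>x\<in>free_vars \<phi>. bs ! e x = int (s x)"
  shows "Ifm bbs bs (cooper_fm e \<phi>) \<longleftrightarrow> sat nat_struct s \<phi>"
  using assms
proof (induction \<phi> arbitrary: bs e s)
  case (Eq t u)
  then have "\<forall>x\<in>tm_vars t. bs ! e x = int (s x)" "\<forall>x\<in>tm_vars u. bs ! e x = int (s x)"
    by auto
  then show ?case by (simp add: Inum_cooper_tm[of _ bs e s])
next
  case (Ex x \<phi>)
  have *: "Ifm bbs (int a # bs) (cooper_fm ((Suc \<circ> e)(x := 0)) \<phi>)
      \<longleftrightarrow> sat nat_struct (s(x := a)) \<phi>" for a
    using Ex.prems by (intro Ex.IH) auto
  have "Ifm bbs bs (cooper_fm e (Ex x \<phi>))
      \<longleftrightarrow> (\<exists>y\<ge>0. Ifm bbs (y # bs) (cooper_fm ((Suc \<circ> e)(x := 0)) \<phi>))"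
    by simp
  also have "\<dots> \<longleftrightarrow> (\<exists>a. Ifm bbs (int a # bs) (cooper_fm ((Suc \<circ> e)(x := 0)) \<phi>))"
    by (metis nonneg_int_cases of_nat_0_le_iff)
  also have "\<dots> \<longleftrightarrow> sat nat_struct s (Ex x \<phi>)"
    by (simp only: * sat.simps) (simp add: nat_struct_def)
  finally show ?case .
next
  case (Neg \<phi>)
  then have "Ifm bbs bs (cooper_fm e \<phi>) \<longleftrightarrow> sat nat_struct s \<phi>" by simp
  then show ?case by simp
next
  case (Conj \<phi> \<psi>)
  then have "Ifm bbs bs (cooper_fm e \<phi>) \<longleftrightarrow> sat nat_struct s \<phi>"
    "Ifm bbs bs (cooper_fm e \<psi>) \<longleftrightarrow> sat nat_struct s \<psi>" by simp_all
  then show ?case by simp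
qed simp

section \<open>Affine dependence of terms on one variable\<close>

definition norm_upto :: "nat \<Rightarrow> int list \<Rightarrow> int" where
  "norm_upto k bs = 1 + (\<Sum>i<k. \<bar>bs ! i\<bar>)"

lemma norm_upto_mono: "k \<le> l \<Longrightarrow> norm_upto k bs \<le> norm_upto l bs"
  unfolding norm_upto_def by (auto intro!: sum_mono2)

lemma norm_upto_pos: "0 < norm_upto k bs"
  unfolding norm_upto_def by (smt (verit) sum_nonneg)

lemma mult_norm_upto_mono:
  "B \<le> B' \<Longrightarrow> 0 \<le> B \<Longrightarrow> k \<le> l \<Longrightarrow> B * norm_upto k bs \<le> B' * norm_upto l bs"
  by (intro mult_mono norm_upto_mono) (use norm_upto_pos[of l bs] norm_upto_pos[of k bs] in auto)

text \<open>Terms are affine in all variables. The slope \<open>a\<close> depends on the term only,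
  and the remainder is at most linear in finitely many parameters. The summand 1 in
  \<open>norm_upto\<close> lets the same form of bound cover constants.\<close>

lemma Inum_Cons_affine:
  "\<exists>a r B k. 0 \<le> B \<and> (\<forall>n bs. Inum (n # bs) t = a * n + r bs \<and> \<bar>r bs\<bar> \<le> B * norm_upto k bs)"
proof (induction t)
  case (C c)
  show ?case
    by (rule exI[of _ 0], rule exI[of _ "\<lambda>_. c"], rule exI[of _ "\<bar>c\<bar>"], rule exI[of _ 0])
      (simp add: norm_upto_def)
next
  case (Bound i)
  show ?case
  proof (cases i)
    case 0
    then show ?thesis
      by (intro exI[of _ 1] exI[of _ "\<lambda>_. 0"] exI[of _ 0]) (simp add: norm_upto_def)
  next
    case (Suc j)
    then show ?thesis
      by (intro exI[of _ 0] exI[of _ "\<lambda>bs. bs ! j"] exI[of _ 1] exI[of _ "Suc j"])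
        (auto simp: norm_upto_def sum_nonneg)
  qed
next
  case (CN i c t)
  then obtain a r B k where B: "0 \<le> B"
    and *: "\<And>n bs. Inum (n # bs) t = a * n + r bs \<and> \<bar>r bs\<bar> \<le> B * norm_upto k bs"
    by blast
  show ?case
  proof (cases i)
    case 0
    then show ?thesis using B *
      by (intro exI[of _ "c + a"] exI[of _ r] exI[of _ B] exI[of _ k]) (simp add: algebra_simps)
  next
    case (Suc j)
    have "\<bar>c * bs ! j + r bs\<bar> \<le> (\<bar>c\<bar> + B) * norm_upto (Suc j + k) bs" for bs
    proof -
      have "\<bar>c * bs ! j\<bar> \<le> \<bar>c\<bar> * norm_upto (Suc j) bs"
        unfolding abs_mult by (intro mult_left_mono) (auto simp: norm_upto_def sum_nonneg)
      also have "\<dots> \<le> \<bar>c\<bar> * norm_upto (Suc j + k) bs" by (intro mult_norm_upto_mono) auto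
      finally have 1: "\<bar>c * bs ! j\<bar> \<le> \<bar>c\<bar> * norm_upto (Suc j + k) bs" .
      have "B * norm_upto k bs \<le> B * norm_upto (Suc j + k) bs"
        using B by (intro mult_norm_upto_mono) auto
      with 1 *[of 0 bs] show ?thesis by (simp only: distrib_right) linarith
    qed
    with Suc B * show ?thesis
      by (intro exI[of _ a] exI[of _ "\<lambda>bs. c * bs ! j + r bs"] exI[of _ "\<bar>c\<bar> + B"]
          exI[of _ "Suc j + k"]) simp
  qed
next
  case (Neg t)
  then obtain a r B k where "0 \<le> B"
    "\<And>n bs. Inum (n # bs) t = a * n + r bs \<and> \<bar>r bs\<bar> \<le> B * norm_upto k bs"
    by blast
  then show ?case
    by (intro exI[of _ "-a"] exI[of _ "\<lambda>bs. - r bs"] exI[of _ B] exI[of _ k]) simp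
next
  case (Add t u)
  then obtain a r B k a' r' B' k' where B: "0 \<le> B" "0 \<le> B'" and
    *: "\<And>n bs. Inum (n # bs) t = a * n + r bs \<and> \<bar>r bs\<bar> \<le> B * norm_upto k bs"
    "\<And>n bs. Inum (n # bs) u = a' * n + r' bs \<and> \<bar>r' bs\<bar> \<le> B' * norm_upto k' bs"
    by blast
  have "\<bar>r bs + r' bs\<bar> \<le> (B + B') * norm_upto (k + k') bs" for bs
  proof -
    have "B * norm_upto k bs \<le> B * norm_upto (k + k') bs"
      "B' * norm_upto k' bs \<le> B' * norm_upto (k + k') bs"
      using B by (auto intro!: mult_norm_upto_mono)
    with *(1)[of 0 bs] *(2)[of 0 bs] show ?thesis by (simp only: distrib_right) linarith
  qed
  with B * show ?case
    by (intro exI[of _ "a + a'"] exI[of _ "\<lambda>bs. r bs + r' bs"] exI[of _ "B + B'"]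
        exI[of _ "k + k'"]) (simp add: algebra_simps)
next
  case (Sub t u)
  then obtain a r B k a' r' B' k' where B: "0 \<le> B" "0 \<le> B'" and
    *: "\<And>n bs. Inum (n # bs) t = a * n + r bs \<and> \<bar>r bs\<bar> \<le> B * norm_upto k bs"
    "\<And>n bs. Inum (n # bs) u = a' * n + r' bs \<and> \<bar>r' bs\<bar> \<le> B' * norm_upto k' bs"
    by blast
  have "\<bar>r bs - r' bs\<bar> \<le> (B + B') * norm_upto (k + k') bs" for bs
  proof -
    have "B * norm_upto k bs \<le> B * norm_upto (k + k') bs"
      "B' * norm_upto k' bs \<le> B' * norm_upto (k + k') bs"
      using B by (auto intro!: mult_norm_upto_mono)
    with *(1)[of 0 bs] *(2)[of 0 bs] show ?thesis by (simp only: distrib_right) linarith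
  qed
  with B * show ?case
    by (intro exI[of _ "a - a'"] exI[of _ "\<lambda>bs. r bs - r' bs"] exI[of _ "B + B'"]
        exI[of _ "k + k'"]) (simp add: algebra_simps)
next
  case (Mul c t)
  then obtain a r B k where B: "0 \<le> B" and
    *: "\<And>n bs. Inum (n # bs) t = a * n + r bs \<and> \<bar>r bs\<bar> \<le> B * norm_upto k bs"
    by blast
  have "\<bar>c * r bs\<bar> \<le> (\<bar>c\<bar> * B) * norm_upto k bs" for bs
    using *[of 0 bs] by (simp add: abs_mult mult.assoc mult_left_mono)
  with B * show ?case
    by (intro exI[of _ "c * a"] exI[of _ "\<lambda>bs. c * r bs"] exI[of _ "\<bar>c\<bar> * B"] exI[of _ k])
      (simp add: algebra_simps)
qed

section \<open>Periodicity of quantifier-free formulas\<close>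

definition periodic_beyond :: "int \<Rightarrow> int \<Rightarrow> nat \<Rightarrow> (int \<Rightarrow> int list \<Rightarrow> bool) \<Rightarrow> bool" where
  "periodic_beyond N B k P \<longleftrightarrow> 0 < N \<and> 0 \<le> B \<and>
     (\<forall>n bs. B * norm_upto k bs < n \<longrightarrow> (P (n + N) bs \<longleftrightarrow> P n bs))"

lemma periodic_beyond_shift:
  assumes "periodic_beyond N B k P" "B * norm_upto k bs < n"
  shows "P (n + N * int j) bs \<longleftrightarrow> P n bs"
proof (induction j)
  case (Suc j)
  have "0 \<le> N * int j" using assms(1) by (simp add: periodic_beyond_def)
  then have "B * norm_upto k bs < n + N * int j" using assms(2) by linarith
  then have "P (n + N * int j) bs \<longleftrightarrow> P (n + N * int j + N) bs"
    using assms(1) unfolding periodic_beyond_def by blast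
  with Suc show ?case by (simp add: algebra_simps)
qed simp

lemma periodic_beyond_weaken:
  assumes "periodic_beyond N B k P" "0 < M" "B \<le> B'" "k \<le> k'"
  shows "periodic_beyond (N * M) B' k' P"
  unfolding periodic_beyond_def
proof (intro conjI allI impI)
  show "0 < N * M" "0 \<le> B'" using assms by (auto simp: periodic_beyond_def)
  fix n bs assume "B' * norm_upto k' bs < n"
  moreover have "B * norm_upto k bs \<le> B' * norm_upto k' bs"
    using assms by (intro mult_norm_upto_mono) (auto simp: periodic_beyond_def)
  ultimately have "B * norm_upto k bs < n" by linarith
  from periodic_beyond_shift[OF assms(1) this, of "nat M"] assms(2)
  show "P (n + N * M) bs \<longleftrightarrow> P n bs" by simp
qed

text \<open>The product of the periods and the sums of the bounds serve both relations at once; an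
  arbitrary \<open>g\<close> treats all binary connectives together.\<close>

lemma periodic_beyond_combine:
  assumes "\<exists>N B k. periodic_beyond N B k P" "\<exists>N B k. periodic_beyond N B k Q"
    and "\<And>n bs. R n bs \<longleftrightarrow> g (P n bs) (Q n bs)"
  shows "\<exists>N B k. periodic_beyond N B k R"
proof -
  from assms(1,2) obtain N B k N' B' k' where
    *: "periodic_beyond N B k P" "periodic_beyond N' B' k' Q" by blast
  then have pos: "0 < N" "0 < N'" "0 \<le> B" "0 \<le> B'" unfolding periodic_beyond_def by blast+
  have "periodic_beyond (N * N') (B + B') (k + k') P"
    by (rule periodic_beyond_weaken[OF *(1)]) (use pos in auto)
  moreover have "periodic_beyond (N * N') (B + B') (k + k') Q"
    using periodic_beyond_weaken[OF *(2), of N "B + B'" "k + k'"] pos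
    by (simp add: mult.commute)
  ultimately have "periodic_beyond (N * N') (B + B') (k + k') R"
    by (simp add: periodic_beyond_def assms(3))
  then show ?thesis by blast
qed

text \<open>Once \<open>n\<close> exceeds the bound on the remainder, the sign of
  \<open>a * n + r bs\<close> is that of \<open>a\<close>, or that of \<open>r bs\<close> if
  \<open>a = 0\<close>, so it no longer changes with \<open>n\<close>. The predicate
  \<open>g\<close> on signs covers all comparison atoms.\<close>

lemma periodic_beyond_sign:
  "\<exists>B k. periodic_beyond 1 B k (\<lambda>n bs. g (sgn (Inum (n # bs) t)))"
proof -
  obtain a r B k where B: "0 \<le> B"
    and *: "\<And>n bs. Inum (n # bs) t = a * n + r bs \<and> \<bar>r bs\<bar> \<le> B * norm_upto k bs"
    using Inum_Cons_affine[of t] by blast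
  have "sgn (a * (n + 1) + r bs) = sgn (a * n + r bs)" if n: "B * norm_upto k bs < n" for n bs
  proof -
    have r: "\<bar>r bs\<bar> < n" using *[of 0 bs] n by linarith
    consider "a = 0" | "a \<ge> 1" | "a \<le> -1" by linarith
    then show ?thesis
    proof cases
      case 2
      then have "n \<le> a * n" "n + 1 \<le> a * (n + 1)"
        using r mult_right_mono[of 1 a n] mult_right_mono[of 1 a "n + 1"] by auto
      with r show ?thesis by (auto simp: sgn_if)
    next
      case 3
      then have "a * n \<le> - n" "a * (n + 1) \<le> - (n + 1)"
        using r mult_right_mono[of a "-1" n] mult_right_mono[of a "-1" "n + 1"] by auto
      with r show ?thesis by (auto simp: sgn_if)
    qed simp
  qed
  with B * have "periodic_beyond 1 B k (\<lambda>n bs. g (sgn (Inum (n # bs) t)))"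
    unfolding periodic_beyond_def by simp
  then show ?thesis by blast
qed

text \<open>Adding \<open>\<bar>i\<bar>\<close> to \<open>n\<close> changes the term by a multiple
  of \<open>i\<close>. Divisibility by 0 is the equation with 0, which is a condition on the
  sign.\<close>

lemma periodic_beyond_dvd:
  "\<exists>N B k. periodic_beyond N B k (\<lambda>n bs. i dvd Inum (n # bs) t)"
proof (cases "i = 0")
  case True
  then show ?thesis
    using periodic_beyond_sign[of "\<lambda>z. z = 0" t] by (auto simp: sgn_0_0)
next
  case False
  obtain a r where *: "\<And>n bs. Inum (n # bs) t = a * n + r bs"
    using Inum_Cons_affine[of t] by blast
  have "i dvd a * (n + \<bar>i\<bar>) + r bs \<longleftrightarrow> i dvd a * n + r bs" for n bs
  proof -
    have "a * (n + \<bar>i\<bar>) + r bs = a * n + r bs + a * \<bar>i\<bar>" by (simp add: algebra_simps)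
    moreover have "i dvd a * \<bar>i\<bar>" by simp
    ultimately show ?thesis by (metis dvd_add_left_iff)
  qed
  with False have "periodic_beyond \<bar>i\<bar> 0 0 (\<lambda>n bs. i dvd Inum (n # bs) t)"
    by (simp add: periodic_beyond_def *)
  then show ?thesis by blast
qed

lemma periodic_beyond_qfree:
  "qfree p \<Longrightarrow> \<exists>N B k. periodic_beyond N B k (\<lambda>n bs. Ifm bbs (n # bs) p)"
proof (induction p)
  case T show ?case by (intro exI[of _ 1]) (simp add: periodic_beyond_def)
next
  case F show ?case by (intro exI[of _ 1]) (simp add: periodic_beyond_def)
next
  case (Lt t) show ?case
    using periodic_beyond_sign[of "\<lambda>z. z < 0" t] by auto
next
  case (Le t) show ?case
    using periodic_beyond_sign[of "\<lambda>z. \<not> 0 < z" t] by (auto simp: not_less)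
next
  case (Gt t) show ?case
    using periodic_beyond_sign[of "\<lambda>z. z > 0" t] by auto
next
  case (Ge t) show ?case
    using periodic_beyond_sign[of "\<lambda>z. \<not> z < 0" t] by (auto simp: not_less)
next
  case (Eq t) show ?case
    using periodic_beyond_sign[of "\<lambda>z. z = 0" t] by (auto simp: sgn_0_0)
next
  case (NEq t) show ?case
    using periodic_beyond_sign[of "\<lambda>z. z \<noteq> 0" t] by (auto simp: sgn_0_0)
next
  case (Dvd i t) show ?case by (simp add: periodic_beyond_dvd)
next
  case (NDvd i t) show ?case
    using periodic_beyond_dvd[of i t] by (simp add: periodic_beyond_def)
next
  case (Not p) then show ?case by (simp add: periodic_beyond_def)
next
  case (And p q)
  show ?case
    by (rule periodic_beyond_combine[OF And.IH, where g = "(\<and>)"]) (use And.prems in simp_all)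
next
  case (Or p q)
  show ?case
    by (rule periodic_beyond_combine[OF Or.IH, where g = "(\<or>)"]) (use Or.prems in simp_all)
next
  case (Imp p q)
  show ?case
    by (rule periodic_beyond_combine[OF Imp.IH, where g = "(\<longrightarrow>)"]) (use Imp.prems in simp_all)
next
  case (Iff p q)
  show ?case
    by (rule periodic_beyond_combine[OF Iff.IH, where g = "(=)"]) (use Iff.prems in simp_all)
next
  case (Closed n) show ?case by (intro exI[of _ 1]) (simp add: periodic_beyond_def)
next
  case (NClosed n) show ?case by (intro exI[of _ 1]) (simp add: periodic_beyond_def)
qed auto

section \<open>Periodicity of definable relations on the naturals\<close>

lemma finite_tm_vars: "finite (tm_vars t)"
  by (induction t) auto

lemma finite_free_vars: "finite (free_vars \<phi>)"
  by (induction \<phi>) (auto simp: finite_tm_vars)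

text \<open>Relations are predicates on whole assignments, so that closure under connectives,
  quantifiers and renaming can be stated without fixing an arity.\<close>

definition definable :: "((nat \<Rightarrow> nat) \<Rightarrow> bool) \<Rightarrow> bool" where
  "definable R \<longleftrightarrow> (\<exists>\<phi>. \<forall>s. R s \<longleftrightarrow> sat nat_struct s \<phi>)"

text \<open>Cooper's elimination \<open>pa\<close> reduces this to the quantifier-free case.
  Variable 0 is the one that moves, so the sum over the parameters starts at 1.\<close>

lemma definable_eventually_periodic:
  assumes "definable R"
  shows "\<exists>N B k. 0 < N \<and>
    (\<forall>s n. B * (1 + (\<Sum>i=1..<k. s i)) < n \<longrightarrow> (R (s(0 := n + N)) \<longleftrightarrow> R (s(0 := n))))"
proof -
  obtain \<phi> where \<phi>: "\<And>s. R s \<longleftrightarrow> sat nat_struct s \<phi>"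
    using assms by (auto simp: definable_def)
  define p where "p = pa (cooper_fm id \<phi>)"
  obtain N B k where "periodic_beyond N B k (\<lambda>n bs. Ifm [] (n # bs) p)"
    using periodic_beyond_qfree[of p "[]"] mirqe[of "[]" "[]"] unfolding p_def by blast
  moreover obtain l where l: "free_vars \<phi> \<subseteq> {..<l}"
    using finite_free_vars[of \<phi>] finite_nat_set_iff_bounded by (metis lessThan_iff subsetI)
  \<comment> \<open>\<open>k\<close> counts the parameters in the threshold and \<open>l\<close>
    bounds the free variables; the list \<open>bs s\<close> has to be long enough for both.\<close>
  define m where "m = k + l"
  have "k \<le> m" "free_vars \<phi> \<subseteq> {..<Suc m}" using l by (auto simp: m_def)
  ultimately have per: "periodic_beyond N B m (\<lambda>n bs. Ifm [] (n # bs) p)"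
    using periodic_beyond_weaken[of N B k _ 1 B m] by simp
  have N: "0 < N" and B: "0 \<le> B" using per by (auto simp: periodic_beyond_def)
  define bs where "bs s = map (\<lambda>i. int (s (Suc i))) [0..<m]" for s
  have R: "R (s(0 := n)) \<longleftrightarrow> Ifm [] (int n # bs s) p" for s n
  proof -
    have "(int n # bs s) ! x = int ((s(0 := n)) x)" if "x < Suc m" for x
      using that by (cases x) (auto simp: bs_def)
    with \<open>free_vars \<phi> \<subseteq> {..<Suc m}\<close>
    have "\<forall>x\<in>free_vars \<phi>. (int n # bs s) ! id x = int ((s(0 := n)) x)"
      by (metis id_apply lessThan_iff subsetD)
    from Ifm_cooper_fm[OF this, of "[]"] show ?thesis
      unfolding \<phi> p_def using mirqe by blast
  qed
  have norm: "norm_upto m (bs s) = int (1 + (\<Sum>i=1..<Suc m. s i))" for s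
  proof -
    have "(\<Sum>i<m. \<bar>bs s ! i\<bar>) = (\<Sum>i<m. int (s (Suc i)))"
      by (rule sum.cong) (auto simp: bs_def)
    also have "\<dots> = int (\<Sum>i=1..<Suc m. s i)"
      using sum.shift_bounds_Suc_ivl[of s 0 m] by (simp add: atLeast0LessThan)
    finally show ?thesis by (simp add: norm_upto_def)
  qed
  have "R (s(0 := n + nat N)) \<longleftrightarrow> R (s(0 := n))"
    if "nat B * (1 + (\<Sum>i=1..<Suc m. s i)) < n" for s n
  proof -
    have "B * norm_upto m (bs s) < int n"
      using that B unfolding norm
      by (metis int_nat_eq of_nat_less_iff of_nat_mult)
    then have "Ifm [] ((int n + N) # bs s) p \<longleftrightarrow> Ifm [] (int n # bs s) p"
      using per unfolding periodic_beyond_def by blast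
    then show ?thesis using N unfolding R by simp
  qed
  with N show ?thesis by (metis zero_less_nat_eq)
qed

text \<open>\<open>N\<close> is fixed before \<open>M\<close> and \<open>s\<close>. Hence several
  relations can share one period, and the period may itself be inserted as a parameter; only the
  threshold \<open>b\<close> reacts to that.\<close>

lemma definable_uniform_period:
  assumes "definable R"
  shows "\<exists>N>0. \<forall>M. N dvd M \<longrightarrow> (\<forall>s. \<exists>b. \<forall>n>b. R (s(0 := n + M)) \<longleftrightarrow> R (s(0 := n)))"
proof -
  obtain N B k where N: "0 < N" and
    per: "\<And>s n. B * (1 + (\<Sum>i=1..<k. s i)) < n \<Longrightarrow> R (s(0 := n + N)) \<longleftrightarrow> R (s(0 := n))"
    using definable_eventually_periodic[OF assms] by blast
  have "R (s(0 := n + N * j)) \<longleftrightarrow> R (s(0 := n))"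
    if "B * (1 + (\<Sum>i=1..<k. s i)) < n" for s n j
  proof (induction j)
    case (Suc j)
    have "B * (1 + (\<Sum>i=1..<k. s i)) < n + N * j" using that by linarith
    from per[OF this] Suc show ?case by (metis add.assoc add.commute mult_Suc_right)
  qed simp
  then have "\<exists>b. \<forall>n>b. R (s(0 := n + M)) \<longleftrightarrow> R (s(0 := n))" if "N dvd M" for s M
    using that by (metis dvdE)
  with N show ?thesis by blast
qed

section \<open>Definable relations\<close>

lemma tm_val_cong: "(\<forall>x\<in>tm_vars t. s x = s' x) \<Longrightarrow> tm_val M s t = tm_val M s' t"
  by (induction t) auto

lemma sat_cong: "(\<forall>x\<in>free_vars \<phi>. s x = s' x) \<Longrightarrow> sat M s \<phi> \<longleftrightarrow> sat M s' \<phi>"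
proof (induction \<phi> arbitrary: s s')
  case (Eq t u)
  then have "tm_val M s t = tm_val M s' t" "tm_val M s u = tm_val M s' u"
    by (auto intro!: tm_val_cong)
  then show ?case by simp
next
  case (Neg \<phi>)
  from Neg.IH[of s s'] Neg.prems show ?case by simp
next
  case (Conj \<phi> \<psi>)
  from Conj.IH(1)[of s s'] Conj.IH(2)[of s s'] Conj.prems show ?case by simp
next
  case (Ex x \<phi>)
  have "sat M (s(x := a)) \<phi> \<longleftrightarrow> sat M (s'(x := a)) \<phi>" for a
    using Ex.prems by (intro Ex.IH) auto
  then show ?case by simp
qed simp

text \<open>\<open>ren\<close> need not be injective, so variables may also be identified.\<close>

lemma rename_formula:
  "\<exists>\<psi>. free_vars \<psi> \<subseteq> ren ` free_vars \<phi> \<and> (\<forall>s. sat M s \<psi> \<longleftrightarrow> sat M (s \<circ> ren) \<phi>)"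
proof (induction \<phi> arbitrary: ren)
  case Top
  show ?case by (rule exI[of _ Top]) simp
next
  case (Eq t u)
  have "\<exists>t'. tm_vars t' \<subseteq> ren ` tm_vars t \<and> (\<forall>s. tm_val M s t' = tm_val M (s \<circ> ren) t)" for t
  proof (induction t)
    case (Var x)
    show ?case by (rule exI[of _ "Var (ren x)"]) simp
  next
    case (Plus t u)
    then obtain t' u' where
      "tm_vars t' \<subseteq> ren ` tm_vars t" "\<forall>s. tm_val M s t' = tm_val M (s \<circ> ren) t"
      "tm_vars u' \<subseteq> ren ` tm_vars u" "\<forall>s. tm_val M s u' = tm_val M (s \<circ> ren) u" by blast
    then have "tm_vars (Plus t' u') \<subseteq> ren ` tm_vars (Plus t u)"
      "\<forall>s. tm_val M s (Plus t' u') = tm_val M (s \<circ> ren) (Plus t u)"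
      by (simp_all only: tm_vars.simps tm_val.simps image_Un Un_mono) blast+
    then show ?case by blast
  qed
  then obtain t' u' where
    "tm_vars t' \<subseteq> ren ` tm_vars t" "\<forall>s. tm_val M s t' = tm_val M (s \<circ> ren) t"
    "tm_vars u' \<subseteq> ren ` tm_vars u" "\<forall>s. tm_val M s u' = tm_val M (s \<circ> ren) u" by meson
  then have "free_vars (Defs.Eq t' u') \<subseteq> ren ` free_vars (Defs.Eq t u)"
    "\<forall>s. sat M s (Defs.Eq t' u') \<longleftrightarrow> sat M (s \<circ> ren) (Defs.Eq t u)"
    by (simp_all only: free_vars.simps sat.simps image_Un Un_mono) blast+
  then show ?case by blast
next
  case (Neg \<phi>)
  then obtain \<psi> where
    "free_vars \<psi> \<subseteq> ren ` free_vars \<phi>" "\<forall>s. sat M s \<psi> \<longleftrightarrow> sat M (s \<circ> ren) \<phi>" by blast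
  then show ?case
    by (intro exI[of _ "Defs.Neg \<psi>"]) (simp only: free_vars.simps sat.simps, blast)
next
  case (Conj \<phi>1 \<phi>2)
  obtain \<psi>1 where
    1: "free_vars \<psi>1 \<subseteq> ren ` free_vars \<phi>1" "\<forall>s. sat M s \<psi>1 \<longleftrightarrow> sat M (s \<circ> ren) \<phi>1"
    using Conj.IH(1) by blast
  obtain \<psi>2 where
    2: "free_vars \<psi>2 \<subseteq> ren ` free_vars \<phi>2" "\<forall>s. sat M s \<psi>2 \<longleftrightarrow> sat M (s \<circ> ren) \<phi>2"
    using Conj.IH(2) by blast
  from 1 2 show ?case
    by (intro exI[of _ "Conj \<psi>1 \<psi>2"]) (simp only: free_vars.simps sat.simps image_Un, blast)
next
  case (Ex x \<phi>)
  have "finite (ren ` free_vars \<phi>)" by (simp add: finite_free_vars)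
  \<comment> \<open>The bound variable is replaced by one outside the image of the free variables,
    so that no renamed variable is captured.\<close>
  then obtain z where z: "z \<notin> ren ` free_vars \<phi>"
    using ex_new_if_finite infinite_UNIV_nat by blast
  obtain \<psi> where
    fv: "free_vars \<psi> \<subseteq> ren(x := z) ` free_vars \<phi>" and
    sat: "\<And>s. sat M s \<psi> \<longleftrightarrow> sat M (s \<circ> ren(x := z)) \<phi>" using Ex.IH by metis
  have "sat M (s(z := a)) \<psi> \<longleftrightarrow> sat M ((s \<circ> ren)(x := a)) \<phi>" for s a
    unfolding sat by (rule sat_cong) (use z in auto)
  moreover have "free_vars \<psi> - {z} \<subseteq> ren ` (free_vars \<phi> - {x})" using fv by auto
  ultimately show ?case
    by (intro exI[of _ "Ex z \<psi>"]) (simp only: free_vars.simps sat.simps, blast)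
qed

lemma definable_rename: "definable R \<Longrightarrow> definable (\<lambda>s. R (s \<circ> ren))"
  unfolding definable_def using rename_formula by metis

lemma definable_rename2:
  assumes "definable (\<lambda>s. R (s 0) (s 1))"
  shows "definable (\<lambda>s. R (s i) (s j))"
  using definable_rename[OF assms, of "\<lambda>n. if n = 0 then i else j"] by simp

lemma definable_rename3:
  assumes "definable (\<lambda>s. R (s 0) (s 1) (s 2))"
  shows "definable (\<lambda>s. R (s i) (s j) (s k))"
  using definable_rename[OF assms, of "\<lambda>n. if n = 0 then i else if n = 1 then j else k"] by simp

lemma definable_Not: "definable R \<Longrightarrow> definable (\<lambda>s. \<not> R s)"
  unfolding definable_def by (metis sat.simps(3))

lemma definable_conj: "definable P \<Longrightarrow> definable Q \<Longrightarrow> definable (\<lambda>s. P s \<and> Q s)"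
  unfolding definable_def by (metis sat.simps(4))

lemma definable_disj: "definable P \<Longrightarrow> definable Q \<Longrightarrow> definable (\<lambda>s. P s \<or> Q s)"
  using definable_Not[OF definable_conj[OF definable_Not definable_Not]] by simp

text \<open>The second assumption says that \<open>Q\<close> does not look at variable
  \<open>x\<close> of the assignment, which makes \<open>x\<close> available as the bound
  variable.\<close>

lemma definable_Ex:
  assumes "definable (\<lambda>s. Q s (s x))" and "\<And>s a b. Q (s(x := a)) b \<longleftrightarrow> Q s b"
  shows "definable (\<lambda>s. \<exists>a. Q s a)"
proof -
  obtain \<phi> where \<phi>: "\<And>s. sat nat_struct s \<phi> \<longleftrightarrow> Q s (s x)"
    using assms(1) by (auto simp: definable_def)
  have "(\<exists>a. Q s a) \<longleftrightarrow> (\<exists>a\<in>elems nat_struct. sat nat_struct (s(x := a)) \<phi>)" for s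
    unfolding \<phi> by (simp add: assms(2) nat_struct_def)
  then have "(\<exists>a. Q s a) \<longleftrightarrow> sat nat_struct s (Ex x \<phi>)" for s
    by simp
  then show ?thesis unfolding definable_def by blast
qed

lemma definable_False: "definable (\<lambda>s. False)"
  unfolding definable_def by (rule exI[of _ "Defs.Neg Top"]) simp

lemma definable_finite_Bex:
  "finite X \<Longrightarrow> (\<And>x. x \<in> X \<Longrightarrow> definable (R x)) \<Longrightarrow> definable (\<lambda>s. \<exists>x\<in>X. R x s)"
  by (induction X rule: finite_induct) (auto intro: definable_disj definable_False)

lemma definable_add: "definable (\<lambda>s. s i = s j + s k)"
  unfolding definable_def
  by (rule exI[of _ "Defs.Eq (Var i) (Plus (Var j) (Var k))"]) (simp add: nat_struct_def)

lemma definable_eq: "definable (\<lambda>s. s i = s j)"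
  unfolding definable_def by (rule exI[of _ "Defs.Eq (Var i) (Var j)"]) simp

lemma definable_less: "definable (\<lambda>s. s i < s j)"
proof -
  \<comment> \<open>With the arguments at variables 0 and 1, variable 2 is fresh for the quantifier;
    renaming then gives arbitrary \<open>i\<close> and \<open>j\<close>. The same device recurs
    below.\<close>
  have "definable (\<lambda>s. s 0 < s 1)"
  proof -
    have "definable (\<lambda>s. (\<exists>a. s 1 = s 0 + a) \<and> \<not> s 0 = s 1)"
      by (intro definable_conj definable_Not definable_eq definable_Ex[where x = 2] definable_add) simp
    moreover have "(\<exists>a. s 1 = s 0 + a) \<and> \<not> s 0 = s 1 \<longleftrightarrow> s 0 < s 1" for s :: "nat \<Rightarrow> nat"
      by (metis le_iff_add nat_less_le)
    ultimately show ?thesis by simp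
  qed
  then show ?thesis by (rule definable_rename2)
qed

lemma definable_const: "definable (\<lambda>s. s i = c)"
proof (induction c arbitrary: i)
  case 0
  \<comment> \<open>Zero is the only solution of \<open>n = n + n\<close>.\<close>
  show ?case using definable_add[of i i i] by simp
next
  case (Suc c)
  have "definable (\<lambda>s. s 0 = Suc c)"
  proof -
    \<comment> \<open>The successor of \<open>c\<close> is the number above \<open>c\<close> with
      nothing strictly between.\<close>
    have "definable (\<lambda>s. \<exists>u. u = c \<and> u < s 0 \<and> \<not> (\<exists>v. u < v \<and> v < s 0))"
      by (intro definable_conj definable_Not definable_Ex[where x = 1] definable_Ex[where x = 2]
          definable_less Suc) auto
    moreover have "(\<exists>u. u = c \<and> u < n \<and> \<not> (\<exists>v. u < v \<and> v < n)) \<longleftrightarrow> n = Suc c" for n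
      by (auto intro: Suc_lessI)
    ultimately show ?thesis by simp
  qed
  then show ?case using definable_rename2[of "\<lambda>n _. n = Suc c"] by simp
qed

lemma definable_affine: "definable (\<lambda>s. s i = c + N * s j)"
proof (induction N arbitrary: i j)
  case 0
  show ?case by (simp add: definable_const)
next
  case (Suc N)
  have "definable (\<lambda>s. s 0 = c + Suc N * s 1)"
  proof -
    have "definable (\<lambda>s. \<exists>u. u = c + N * s 1 \<and> s 0 = u + s 1)"
      by (intro definable_conj definable_Ex[where x = 2] definable_add Suc) simp
    then show ?thesis by (simp add: algebra_simps)
  qed
  then show ?case by (rule definable_rename2)
qed

lemma definable_progression: "definable (\<lambda>s. \<exists>j. s 0 = a + N * j \<and> s 1 = c + d * j)"
  by (intro definable_conj definable_Ex[where x = 2] definable_affine) simp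

lemma definable_finite_graph:
  assumes "finite X"
  shows "definable (\<lambda>s. s 0 \<in> X \<and> f (s 0) = s 1)"
proof -
  \<comment> \<open>A single point of the graph is a progression with both steps 0.\<close>
  have "definable (\<lambda>s. \<exists>x\<in>X. \<exists>j. s 0 = x + 0 * j \<and> s 1 = f x + 0 * j)"
    by (intro definable_finite_Bex assms definable_progression)
  moreover have "(\<exists>x\<in>X. \<exists>j. n = x + 0 * j \<and> m = f x + 0 * j) \<longleftrightarrow> n \<in> X \<and> f n = m"
    for n m :: nat by auto
  ultimately show ?thesis by simp
qed

lemma definable_obtain_formula:
  assumes "definable (\<lambda>s. R (s 0) (s 1))"
  obtains \<phi> where "free_vars \<phi> \<subseteq> {..<2}" "\<And>s. sat nat_struct s \<phi> \<longleftrightarrow> R (s 0) (s 1)"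
proof -
  obtain \<phi> where \<phi>: "\<And>s. sat nat_struct s \<phi> \<longleftrightarrow> R (s 0) (s 1)"
    using assms unfolding definable_def by blast
  \<comment> \<open>All variables above 1 are merged into variable 1. This is harmless because the
    truth of \<open>\<phi>\<close> depends on the values at 0 and 1 only.\<close>
  obtain \<psi> where "free_vars \<psi> \<subseteq> (\<lambda>i. min i 1) ` free_vars \<phi>"
    "\<And>s. sat nat_struct s \<psi> \<longleftrightarrow> sat nat_struct (s \<circ> (\<lambda>i. min i 1)) \<phi>"
    using rename_formula by metis
  then show ?thesis by (intro that[of \<psi>]) (auto simp: \<phi>)
qed

section \<open>Models of Presburger Arithmetic\<close>

lemma valid_in_All:
  fixes M :: "'a plus_struct"
  shows "valid_in M (Defs.Neg (Ex x (Defs.Neg \<phi>))) \<longleftrightarrow> valid_in M \<phi>"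
proof
  assume valid: "valid_in M (Defs.Neg (Ex x (Defs.Neg \<phi>)))"
  show "valid_in M \<phi>"
    unfolding valid_in_def
  proof (intro allI impI)
    fix s :: "nat \<Rightarrow> 'a" assume s: "range s \<subseteq> elems M"
    then have "\<forall>a\<in>elems M. sat M (s(x := a)) \<phi>" using valid unfolding valid_in_def by simp
    then have "sat M (s(x := s x)) \<phi>" using s by blast
    then show "sat M s \<phi>" by simp
  qed
next
  assume valid: "valid_in M \<phi>"
  have "range (s(x := a)) \<subseteq> elems M" if "range s \<subseteq> elems M" "a \<in> elems M"
    for s :: "nat \<Rightarrow> 'a" and a
    using that by auto
  with valid have "\<forall>s. range s \<subseteq> elems M \<longrightarrow> (\<forall>a\<in>elems M. sat M (s(x := a)) \<phi>)"
    unfolding valid_in_def by blast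
  then show "valid_in M (Defs.Neg (Ex x (Defs.Neg \<phi>)))"
    by (simp add: valid_in_def)
qed

text \<open>\<open>PrA\<close> contains sentences only; the universal closure \<open>cl xs\<close>
  of \<open>\<phi>\<close> is one, and it is valid in a structure exactly when \<open>\<phi>\<close>
  is.\<close>

lemma model_PrA_valid_in:
  assumes "model_PrA M" "valid_in nat_struct \<phi>"
  shows "valid_in M \<phi>"
proof -
  define cl where "cl xs = foldr (\<lambda>x \<psi>. Defs.Neg (Ex x (Defs.Neg \<psi>))) xs \<phi>" for xs
  have valid: "valid_in N (cl xs) \<longleftrightarrow> valid_in N \<phi>" for xs and N :: "'b plus_struct"
    by (induction xs) (simp_all add: cl_def valid_in_All del: sat.simps)
  have free: "free_vars (cl xs) = free_vars \<phi> - set xs" for xs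
    by (induction xs) (auto simp: cl_def)
  obtain xs where xs: "set xs = free_vars \<phi>"
    using finite_list[OF finite_free_vars] by blast
  have "cl xs \<in> PrA"
    using assms(2) unfolding PrA_def mem_Collect_eq free valid by (simp add: xs)
  then have "valid_in M (cl xs)" using assms(1) unfolding model_PrA_def by blast
  then show ?thesis unfolding valid .
qed

lemma model_PrA_sat:
  assumes "model_PrA M" "\<And>s. sat nat_struct s \<phi>" "\<And>i. s i \<in> elems M"
  shows "sat M s \<phi>"
  using model_PrA_valid_in[OF assms(1), of \<phi>] assms(2,3) unfolding valid_in_def by blast

abbreviation All :: "nat \<Rightarrow> Defs.fm \<Rightarrow> Defs.fm" where
  "All x \<phi> \<equiv> Defs.Neg (Ex x (Defs.Neg \<phi>))"

lemma model_PrA_closed: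
  "model_PrA M \<Longrightarrow> x \<in> elems M \<Longrightarrow> y \<in> elems M \<Longrightarrow> add M x y \<in> elems M"
  by (auto simp: model_PrA_def is_struct_def)

lemma model_PrA_assoc:
  assumes "model_PrA M" "x \<in> elems M" "y \<in> elems M" "z \<in> elems M"
  shows "add M (add M x y) z = add M x (add M y z)"
proof -
  have "sat nat_struct s (Defs.Eq (Plus (Plus (Var 0) (Var 1)) (Var 2))
      (Plus (Var 0) (Plus (Var 1) (Var 2))))" for s
    by (simp add: nat_struct_def)
  from model_PrA_sat[OF assms(1) this, of "(\<lambda>_. x)(1 := y, 2 := z)"]
  show ?thesis using assms(2-) by simp
qed

lemma model_PrA_commute:
  assumes "model_PrA M" "x \<in> elems M" "y \<in> elems M"
  shows "add M x y = add M y x"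
proof -
  have "sat nat_struct s (Defs.Eq (Plus (Var 0) (Var 1)) (Plus (Var 1) (Var 0)))" for s
    by (simp add: nat_struct_def)
  from model_PrA_sat[OF assms(1) this, of "(\<lambda>_. x)(1 := y)"]
  show ?thesis using assms(2-) by simp
qed

lemma model_PrA_cancel:
  assumes "model_PrA M" "x \<in> elems M" "y \<in> elems M" "z \<in> elems M"
    and "add M x y = add M x z"
  shows "y = z"
proof -
  have "sat nat_struct s (Defs.Neg (Conj
      (Defs.Eq (Plus (Var 0) (Var 1)) (Plus (Var 0) (Var 2)))
      (Defs.Neg (Defs.Eq (Var 1) (Var 2)))))" for s
    by (simp add: nat_struct_def)
  from model_PrA_sat[OF assms(1) this, of "(\<lambda>_. x)(1 := y, 2 := z)"]
  show ?thesis using assms(2-) by simp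
qed

lemma model_PrA_zero:
  assumes "model_PrA M"
  shows "\<exists>z\<in>elems M. \<forall>x\<in>elems M. add M x z = x"
proof -
  obtain x where x: "x \<in> elems M" using assms by (auto simp: model_PrA_def is_struct_def)
  have "sat nat_struct s (Ex 0 (All 1 (Defs.Eq (Plus (Var 1) (Var 0)) (Var 1))))" for s
    by (simp add: nat_struct_def)
  from model_PrA_sat[OF assms this, of "\<lambda>_. x"] show ?thesis using x by simp
qed

text \<open>The unit is described through the order that addition induces: whatever lies above
  \<open>x\<close> is \<open>x\<close> or lies above \<open>x + e\<close>, and \<open>x + e\<close>
  is never below or equal to \<open>x\<close>.\<close>

lemma model_PrA_one:
  assumes "model_PrA M"
  shows "\<exists>e\<in>elems M.
    (\<forall>x\<in>elems M. \<forall>u\<in>elems M. add M x u = x \<or> (\<exists>w\<in>elems M. add M x u = add M (add M x e) w)) \<and>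
    (\<forall>x\<in>elems M. \<forall>w\<in>elems M. add M (add M x e) w \<noteq> x)"
proof -
  obtain x where x: "x \<in> elems M" using assms by (auto simp: model_PrA_def is_struct_def)
  let ?step = "All 1 (All 2 (Defs.Neg (Conj (Defs.Neg (Defs.Eq (Plus (Var 1) (Var 2)) (Var 1)))
      (Defs.Neg (Ex 3 (Defs.Eq (Plus (Var 1) (Var 2)) (Plus (Plus (Var 1) (Var 0)) (Var 3))))))))"
  let ?irrefl = "All 1 (All 2 (Defs.Neg (Defs.Eq (Plus (Plus (Var 1) (Var 0)) (Var 2)) (Var 1))))"
  have *: "\<forall>u. u = 0 \<or> (\<exists>w. u = Suc w)" by (metis nat.exhaust)
  have "sat nat_struct (s(0 := Suc 0)) (Conj ?step ?irrefl)" for s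
    using * by (simp add: nat_struct_def)
  moreover have "Suc 0 \<in> elems nat_struct" by (simp add: nat_struct_def)
  ultimately have "sat nat_struct s (Ex 0 (Conj ?step ?irrefl))" for s
    unfolding sat.simps(5)[of _ _ _ "Conj ?step ?irrefl"] by blast
  from model_PrA_sat[OF assms this, of "\<lambda>_. x"] show ?thesis using x by simp
qed

section \<open>Multiples of an element and the standard part\<close>

primrec multiple :: "'a plus_struct \<Rightarrow> 'a \<Rightarrow> 'a \<Rightarrow> nat \<Rightarrow> 'a" where
  "multiple M z a 0 = z"
| "multiple M z a (Suc n) = add M (multiple M z a n) a"

lemma multiple_closed:
  "model_PrA M \<Longrightarrow> z \<in> elems M \<Longrightarrow> a \<in> elems M \<Longrightarrow> multiple M z a n \<in> elems M"
  by (induction n) (auto intro: model_PrA_closed)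

lemma multiple_add:
  assumes "model_PrA M" "z \<in> elems M" "\<forall>x\<in>elems M. add M x z = x" "a \<in> elems M"
  shows "multiple M z a (m + n) = add M (multiple M z a m) (multiple M z a n)"
  by (induction n) (simp_all add: assms multiple_closed model_PrA_assoc)

text \<open>Each \<open>S k\<close> contains a whole tail of some residue class modulo
  \<open>N\<close>. There are \<open>N + 1\<close> sets for \<open>N\<close> classes, so two tails
  lie in one class and overlap from the larger starting point on.\<close>

lemma infinite_periodic_sets_meet:
  fixes S :: "nat \<Rightarrow> nat set"
  assumes "\<And>k. k \<le> N \<Longrightarrow> infinite (S k)" "0 < N"
    and per: "\<And>k. k \<le> N \<Longrightarrow> \<exists>b. \<forall>y>b. y + N \<in> S k \<longleftrightarrow> y \<in> S k"
  shows "\<exists>k l. k < l \<and> l \<le> N \<and> S k \<inter> S l \<noteq> {}"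
proof -
  have "\<exists>y. \<forall>j. y + N * j \<in> S k" if k: "k \<le> N" for k
  proof -
    obtain b where b: "\<And>y. b < y \<Longrightarrow> y + N \<in> S k \<longleftrightarrow> y \<in> S k" using per[OF k] by blast
    obtain y where y: "b < y" "y \<in> S k"
      using assms(1)[OF k] by (meson finite_nat_set_iff_bounded_le not_le)
    have "y + N * j \<in> S k" for j
    proof (induction j)
      case (Suc j)
      have "b < y + N * j" using y by simp
      from b[OF this] Suc show ?case by (simp add: algebra_simps)
    qed (simp add: y)
    then show ?thesis by blast
  qed
  then obtain y where y: "\<And>k j. k \<le> N \<Longrightarrow> y k + N * j \<in> S k" by metis
  have "\<not> inj_on (\<lambda>k. y k mod N) {..N}"
  proof
    assume "inj_on (\<lambda>k. y k mod N) {..N}"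
    then have "card {..N} \<le> card {..<N}"
      by (rule card_inj_on_le) (use assms(2) in auto)
    then show False by simp
  qed
  then obtain k l where kl: "k \<le> N" "l \<le> N" "k \<noteq> l" "y k mod N = y l mod N"
    by (auto simp: inj_on_def)
  have "S k \<inter> S l \<noteq> {}"
    if prems: "k \<le> N" "l \<le> N" "y k mod N = y l mod N" "y k \<le> y l" for k l
  proof -
    obtain j where "y l = y k + N * j"
      using prems(3,4) by (metis mod_eq_dvd_iff_nat dvdE le_add_diff_inverse)
    then have "y l \<in> S k" "y l \<in> S l" using y[OF prems(1), of j] y[OF prems(2), of 0] by simp_all
    then show ?thesis by blast
  qed
  from this[of k l] this[of l k] kl have "S k \<inter> S l \<noteq> {}" by (cases "y k \<le> y l") auto
  moreover have "k < l \<or> l < k" using kl(3) by auto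
  ultimately show ?thesis using kl(1,2) by (blast intro: exI[of _ k] exI[of _ l])
qed

text \<open>For \<open>m < n\<close> the \<open>n\<close>-th multiple lies above the
  \<open>m\<close>-th one plus \<open>e\<close>, hence differs from it.\<close>

lemma multiple_inj:
  assumes M: "model_PrA M" and z: "z \<in> elems M" "\<forall>x\<in>elems M. add M x z = x"
    and e: "e \<in> elems M" "\<forall>x\<in>elems M. \<forall>w\<in>elems M. add M (add M x e) w \<noteq> x"
  shows "inj (multiple M z e)"
proof -
  have "multiple M z e m \<noteq> multiple M z e n" if mn: "m < n" for m n
  proof -
    obtain d where "n = Suc m + d" using less_imp_Suc_add[OF mn] by auto
    then have "multiple M z e n = add M (add M (multiple M z e m) e) (multiple M z e d)"
      using multiple_add[OF M z e(1), of "Suc m" d] by simp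
    also have "\<dots> \<noteq> multiple M z e m"
      using e(2) multiple_closed[OF M z(1) e(1)] by blast
    finally show ?thesis by simp
  qed
  then show ?thesis by (metis injI linorder_neqE_nat)
qed

lemma all_multiples_imp_isomorphic:
  assumes M: "model_PrA M" and z: "z \<in> elems M" "\<forall>x\<in>elems M. add M x z = x"
    and e: "e \<in> elems M" "\<forall>x\<in>elems M. \<forall>w\<in>elems M. add M (add M x e) w \<noteq> x"
    and all: "\<forall>a\<in>elems M. \<exists>n. a = multiple M z e n"
  shows "isomorphic M nat_struct"
proof -
  let ?g = "inv (multiple M z e)"
  have inj: "inj (multiple M z e)" by (rule multiple_inj) fact+
  have g: "?g (multiple M z e n) = n" for n by (simp add: inj)
  have "bij_betw ?g (elems M) (elems nat_struct)"
    by (rule bij_betw_byWitness[where f' = "multiple M z e"])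
      (use all g multiple_closed[OF M z(1) e(1)] in \<open>auto simp: nat_struct_def\<close>)
  moreover have "?g (add M x y) = add nat_struct (?g x) (?g y)"
    if xy: "x \<in> elems M" "y \<in> elems M" for x y
  proof -
    obtain m n where "x = multiple M z e m" "y = multiple M z e n" using all xy by metis
    then show ?thesis using multiple_add[OF M z e(1), of m n, symmetric]
      by (simp add: g nat_struct_def)
  qed
  ultimately show ?thesis unfolding isomorphic_def by blast
qed

text \<open>\<open>D\<close> is the set of codes and \<open>f\<close> maps a code to its element;
  several codes may stand for one element.\<close>

lemma interpreted_model_isomorphic:
  assumes M: "model_PrA M" and im: "f ` D = elems M"
    and def_add: "definable (\<lambda>s. s 0 \<in> D \<and> s 1 \<in> D \<and> s 2 \<in> D \<and> f (s 0) = add M (f (s 1)) (f (s 2)))"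
  shows "isomorphic M nat_struct"
proof -
  obtain z where z: "z \<in> elems M" "\<forall>x\<in>elems M. add M x z = x"
    using model_PrA_zero[OF M] by blast
  obtain e where e: "e \<in> elems M"
    and step: "\<And>x u. x \<in> elems M \<Longrightarrow> u \<in> elems M \<Longrightarrow>
      add M x u = x \<or> (\<exists>w\<in>elems M. add M x u = add M (add M x e) w)"
    and irrefl: "\<forall>x\<in>elems M. \<forall>w\<in>elems M. add M (add M x e) w \<noteq> x"
    using model_PrA_one[OF M] by blast
  note closed = model_PrA_closed[OF M] multiple_closed[OF M z(1)]
  note assoc = model_PrA_assoc[OF M]
  have "\<exists>n. a = multiple M z e n" if a: "a \<in> elems M" for a
  proof (rule ccontr)
    assume nonstandard: "\<nexists>n. a = multiple M z e n"
    \<comment> \<open>An element that is no multiple of \<open>e\<close> exceeds them all: by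
      discreteness the remainder above each multiple contains a further \<open>e\<close>.\<close>
    have below: "\<exists>v\<in>elems M. a = add M (multiple M z e n) v" for n
    proof (induction n)
      case 0
      then show ?case using a z model_PrA_commute[OF M a z(1)] by (intro bexI[of _ a]) auto
    next
      case (Suc n)
      then obtain v where v: "v \<in> elems M" "a = add M (multiple M z e n) v" by blast
      moreover have "a \<noteq> multiple M z e n" using nonstandard by blast
      ultimately show ?case using step[OF closed(2)[OF e] v(1), of n] by auto
    qed
    define add_rel where "add_rel x y w \<longleftrightarrow> x \<in> D \<and> y \<in> D \<and> w \<in> D \<and> f x = add M (f y) (f w)"
      for x y w
    \<comment> \<open>If \<open>c\<close> codes the unit, this says
      \<open>f p \<le> f y < f q\<close>: \<open>u\<close> codes the difference
      \<open>f y - f p\<close>, and \<open>w\<close> codes \<open>f y + e\<close>, which lies below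
      or at \<open>f q\<close>. The unit enters as a variable since definitions have no
      parameters.\<close>
    define between where "between y p q c \<longleftrightarrow>
      (\<exists>u. add_rel y p u) \<and> (\<exists>v w. add_rel w y c \<and> add_rel q w v)" for y p q c
    have def_rel: "definable (\<lambda>s. add_rel (s i) (s j) (s k))" for i j k
      using definable_rename3[of add_rel] def_add unfolding add_rel_def .
    have "definable (\<lambda>s. between (s 0) (s 1) (s 2) (s 3))"
      unfolding between_def
      by (intro definable_conj definable_Ex[where x = 4] definable_Ex[where x = 5] def_rel) simp_all
    from definable_uniform_period[OF this, simplified] obtain N where N: "0 < N" and
      period: "\<forall>L. N dvd L \<longrightarrow> (\<forall>s. \<exists>b. \<forall>n>b. between (n + L) (s (Suc 0)) (s 2) (s 3) \<longleftrightarrow>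
        between n (s (Suc 0)) (s 2) (s 3))"
      by blast
    \<comment> \<open>The period was chosen before \<open>p\<close>, \<open>q\<close> and
      \<open>c\<close>, so it is common to all the intervals below.\<close>
    have per: "\<exists>b. \<forall>n>b. between (n + N) p q c \<longleftrightarrow> between n p q c" for p q c
      using period[rule_format, of N "(\<lambda>_. c)(1 := p, 2 := q)"] by simp
    define rep where "rep = inv_into D f"
    have rep: "rep x \<in> D" "f (rep x) = x" if "x \<in> elems M" for x
      using that im unfolding rep_def by (auto intro: inv_into_into f_inv_into_f)
    \<comment> \<open>\<open>S k\<close> consists of the codes of elements in the interval from
      \<open>k a\<close> (included) to \<open>(k + 1) a\<close> (excluded).\<close>
    define S where "S k = {y. between y (rep (multiple M z a k)) (rep (multiple M z a (Suc k))) (rep e)}"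
      for k
    have S: "y \<in> S k \<longleftrightarrow> y \<in> D \<and> (\<exists>u\<in>elems M. f y = add M (multiple M z a k) u) \<and>
      (\<exists>v\<in>elems M. multiple M z a (Suc k) = add M (add M (f y) e) v)" for y k
    proof
      assume "y \<in> S k"
      then obtain u v w where "add_rel y (rep (multiple M z a k)) u" "add_rel w y (rep e)"
        "add_rel (rep (multiple M z a (Suc k))) w v" by (auto simp: S_def between_def)
      then show "y \<in> D \<and> (\<exists>u\<in>elems M. f y = add M (multiple M z a k) u) \<and>
        (\<exists>v\<in>elems M. multiple M z a (Suc k) = add M (add M (f y) e) v)"
        unfolding add_rel_def using rep closed(2)[OF a] e im
        by (metis image_eqI)
    next
      assume "y \<in> D \<and> (\<exists>u\<in>elems M. f y = add M (multiple M z a k) u) \<and>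
        (\<exists>v\<in>elems M. multiple M z a (Suc k) = add M (add M (f y) e) v)"
      then obtain u v where y: "y \<in> D" and
        u: "u \<in> elems M" "f y = add M (multiple M z a k) u" and
        v: "v \<in> elems M" "multiple M z a (Suc k) = add M (add M (f y) e) v" by blast
      have fy: "f y \<in> elems M" using y im by auto
      have "add_rel y (rep (multiple M z a k)) (rep u)"
        "add_rel (rep (add M (f y) e)) y (rep e)"
        "add_rel (rep (multiple M z a (Suc k))) (rep (add M (f y) e)) (rep v)"
        using y u v rep closed(2)[OF a] closed(1)[OF fy e] e fy unfolding add_rel_def by metis+
      then show "y \<in> S k" unfolding S_def between_def by blast
    qed
    \<comment> \<open>The elements \<open>k a + n e\<close> are distinct and all lie in the
      interval.\<close>
    have "infinite (S k)" for k
    proof -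
      let ?g = "\<lambda>n. rep (add M (multiple M z a k) (multiple M z e n))"
      have "?g n \<in> S k" for n
      proof -
        \<comment> \<open>\<open>Suc n\<close> leaves room for the extra \<open>e\<close> in the
          strict upper bound.\<close>
        obtain v where v: "v \<in> elems M" "a = add M (multiple M z e (Suc n)) v"
          using below by blast
        have "multiple M z a (Suc k) =
            add M (add M (add M (multiple M z a k) (multiple M z e n)) e) v"
          using v assoc closed(1) closed(2)[OF a] closed(2)[OF e] e by simp
        with v rep closed(1) closed(2)[OF a] closed(2)[OF e] show ?thesis
          unfolding S by metis
      qed
      moreover have "inj ?g"
      proof (rule injI)
        fix m n assume "?g m = ?g n"
        then have "add M (multiple M z a k) (multiple M z e m) =
            add M (multiple M z a k) (multiple M z e n)"
          using rep closed(1) closed(2)[OF a] closed(2)[OF e] by metis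
        then have "multiple M z e m = multiple M z e n"
          using model_PrA_cancel[OF M] closed(2)[OF a] closed(2)[OF e] by metis
        then show "m = n" using multiple_inj[OF M z e irrefl] by (simp add: inj_eq)
      qed
      ultimately show ?thesis
        by (metis finite_subset image_subsetI finite_imageD infinite_UNIV_nat)
    qed
    moreover have "\<exists>b. \<forall>y>b. y + N \<in> S k \<longleftrightarrow> y \<in> S k" for k
      unfolding S_def mem_Collect_eq by (rule per)
    ultimately obtain k l where kl: "k < l" "S k \<inter> S l \<noteq> {}"
      using infinite_periodic_sets_meet[OF _ N, of S] by blast
    then obtain y where y_in: "y \<in> S k" "y \<in> S l" by blast
    then have y: "f y \<in> elems M" using S im by blast
    from y_in(2) obtain u where u: "u \<in> elems M" "f y = add M (multiple M z a l) u"
      unfolding S by blast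
    from y_in(1) obtain v where
      v: "v \<in> elems M" "multiple M z a (Suc k) = add M (add M (f y) e) v"
      unfolding S by blast
    \<comment> \<open>A common code \<open>y\<close> would give
      \<open>f y + e \<le> (k + 1) a \<le> l a \<le> f y\<close>, against
      \<open>irrefl\<close>.\<close>
    obtain d where "l = Suc k + d" using less_imp_Suc_add[OF kl(1)] by auto
    then have "multiple M z a l = add M (multiple M z a (Suc k)) (multiple M z a d)"
      using multiple_add[OF M z a] by blast
    then have "f y = add M (add M (add M (add M (f y) e) v) (multiple M z a d)) u"
      using u(2) v(2) by metis
    also have "\<dots> = add M (add M (f y) e) (add M v (add M (multiple M z a d) u))"
      using u v y e closed(1) closed(2)[OF a] by (simp add: assoc)
    finally have "add M (add M (f y) e) (add M v (add M (multiple M z a d) u)) = f y" ..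
    then show False
      using irrefl y u(1) v(1) closed(1) closed(2)[OF a] by blast
  qed
  with all_multiples_imp_isomorphic[OF M z e irrefl] show ?thesis by blast
qed

section \<open>Definability of the isomorphism\<close>

text \<open>If each increment up to \<open>d\<close> occurred only finitely often, all increments
  would eventually be at least \<open>d + 1\<close>, and \<open>a\<close> would outgrow its bound of
  slope \<open>d\<close>.\<close>

lemma bounded_slope_imp_frequent_increment:
  fixes a :: "nat \<Rightarrow> nat"
  assumes mono: "\<And>t. a t \<le> a (Suc t)" and bound: "\<And>t. a t \<le> c + d * t"
  shows "\<exists>v. infinite {t. a (Suc t) = a t + v}"
proof (rule ccontr)
  assume "\<nexists>v. infinite {t. a (Suc t) = a t + v}"
  then have "finite (\<Union>v\<le>d. {t. a (Suc t) = a t + v})" by blast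
  then obtain t0 where t0: "\<And>t. t \<in> (\<Union>v\<le>d. {t. a (Suc t) = a t + v}) \<Longrightarrow> t < t0"
    by (metis finite_nat_set_iff_bounded)
  have step: "a t + Suc d \<le> a (Suc t)" if t: "t0 \<le> t" for t
  proof (rule ccontr)
    assume "\<not> a t + Suc d \<le> a (Suc t)"
    then have "a (Suc t) = a t + (a (Suc t) - a t)" "a (Suc t) - a t \<le> d"
      using mono[of t] by linarith+
    with t0[of t] t show False by auto
  qed
  have "a (t0 + j) \<ge> Suc d * j" for j
  proof (induction j)
    case (Suc j)
    then show ?case using step[of "t0 + j"] by (simp add: algebra_simps)
  qed simp
  \<comment> \<open>From \<open>t0\<close> on, \<open>j\<close> steps give at least
    \<open>(d + 1) * j\<close>, while the bound is \<open>c + d * t0 + d * j\<close>; these conflict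
    as soon as \<open>j > c + d * t0\<close>.\<close>
  from this[of "Suc (c + d * t0)"] bound[of "t0 + Suc (c + d * t0)"] show False
    by (simp add: algebra_simps)
qed

text \<open>An interpretation of the naturals, reduced to its code map \<open>f\<close>. Domain,
  equality and order of codes are all recovered from the one definable relation.\<close>

locale nat_presentation =
  fixes D :: "nat set" and f :: "nat \<Rightarrow> nat"
  assumes onto: "f ` D = UNIV"
    and definable_sum:
      "definable (\<lambda>s. s 0 \<in> D \<and> s 1 \<in> D \<and> s 2 \<in> D \<and> f (s 0) = f (s 1) + f (s 2))"
begin

definition sum_rel :: "nat \<Rightarrow> nat \<Rightarrow> nat \<Rightarrow> bool" where
  "sum_rel x y w \<longleftrightarrow> x \<in> D \<and> y \<in> D \<and> w \<in> D \<and> f x = f y + f w"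

lemma definable_sum_rel: "definable (\<lambda>s. sum_rel (s i) (s j) (s k))"
  using definable_rename3[of sum_rel] definable_sum unfolding sum_rel_def .

lemma obtain_code: obtains x where "x \<in> D" "f x = n"
  using onto by (metis UNIV_I imageE)

lemma definable_domain: "definable (\<lambda>s. s i \<in> D)"
proof -
  \<comment> \<open>A code \<open>x\<close> satisfies \<open>f x = f x + 0\<close>, so a code of 0
    is a witness \<open>w\<close>.\<close>
  have "definable (\<lambda>s. \<exists>w. sum_rel (s 0) (s 0) w)"
    by (intro definable_Ex[where x = 1] definable_sum_rel) simp
  moreover obtain z where "z \<in> D" "f z = 0" by (rule obtain_code)
  then have "(\<exists>w. sum_rel x x w) \<longleftrightarrow> x \<in> D" for x
    by (auto simp: sum_rel_def)
  ultimately show ?thesis using definable_rename2[of "\<lambda>x _. x \<in> D"] by simp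
qed

lemma definable_same: "definable (\<lambda>s. s i \<in> D \<and> s j \<in> D \<and> f (s i) = f (s j))"
proof -
  \<comment> \<open>The first conjunct forces \<open>w\<close> to code 0.\<close>
  have "definable (\<lambda>s. \<exists>w. sum_rel w w w \<and> sum_rel (s 0) (s 1) w)"
    by (intro definable_Ex[where x = 2] definable_conj definable_sum_rel) simp
  moreover obtain z where "z \<in> D" "f z = 0" by (rule obtain_code)
  then have "(\<exists>w. sum_rel w w w \<and> sum_rel x y w) \<longleftrightarrow> x \<in> D \<and> y \<in> D \<and> f x = f y" for x y
    by (auto simp: sum_rel_def intro!: exI[of _ z])
  ultimately have "definable (\<lambda>s. s 0 \<in> D \<and> s 1 \<in> D \<and> f (s 0) = f (s 1))" by simp
  then show ?thesis by (rule definable_rename2)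
qed

lemma definable_le: "definable (\<lambda>s. s i \<in> D \<and> s j \<in> D \<and> f (s i) \<le> f (s j))"
proof -
  have "definable (\<lambda>s. \<exists>w. sum_rel (s 1) (s 0) w)"
    by (intro definable_Ex[where x = 2] definable_sum_rel) simp
  moreover have "(\<exists>w. sum_rel y x w) \<longleftrightarrow> x \<in> D \<and> y \<in> D \<and> f x \<le> f y" for x y
  proof -
    obtain w where "w \<in> D" "f w = f y - f x" by (rule obtain_code)
    then show ?thesis by (auto simp: sum_rel_def intro!: exI[of _ w])
  qed
  ultimately have "definable (\<lambda>s. s 0 \<in> D \<and> s 1 \<in> D \<and> f (s 0) \<le> f (s 1))" by simp
  then show ?thesis by (rule definable_rename2)
qed

text \<open>The least codes of the numbers below \<open>f x\<close> form a finite set definable from \<open>x\<close>, so beyond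
  the linear bound of \<open>definable_eventually_periodic\<close> there are none.\<close>

lemma linear_bound: "\<exists>B. \<forall>x\<in>D. f x \<le> B * (1 + x)"
proof -
  define below where "below y x \<longleftrightarrow> (y \<in> D \<and> x \<in> D \<and> f y \<le> f x) \<and>
    \<not> (y \<in> D \<and> x \<in> D \<and> f y = f x) \<and> \<not> (\<exists>v. v < y \<and> (v \<in> D \<and> y \<in> D \<and> f v = f y))" for y x
  have "definable (\<lambda>s. below (s 0) (s 1))"
    unfolding below_def
    by (intro definable_conj definable_Not definable_Ex[where x = 2] definable_less
        definable_same definable_le) simp
  from definable_eventually_periodic[OF this] obtain N B k where N: "0 < N" and
    per: "\<forall>s n. B * (1 + (\<Sum>i=1..<k. s i)) < n \<longrightarrow>
      (below (n + N) (s (Suc 0)) \<longleftrightarrow> below n (s (Suc 0)))"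
    by auto
  \<comment> \<open>The least codes lie in \<open>{..?b}\<close>, which has
    \<open>B * (1 + x) + 1\<close> elements; \<open>Suc B\<close> absorbs the extra one.\<close>
  have "f x \<le> Suc B * (1 + x)" if x: "x \<in> D" for x
  proof -
    let ?S = "{y. below y x}"
    let ?b = "B * (1 + x)"
    have inj: "inj_on f ?S"
      unfolding below_def inj_on_def by (metis (mono_tags, lifting) linorder_neqE_nat mem_Collect_eq)
    have "f ` ?S \<subseteq> {..<f x}" by (auto simp: below_def)
    with inj have fin: "finite ?S" using finite_imageD finite_subset finite_lessThan by metis
    have "?S \<subseteq> {..?b}"
    proof (rule ccontr)
      assume "\<not> ?S \<subseteq> {..?b}"
      then obtain y where y: "below y x" "?b < y"
        by (metis atMost_iff mem_Collect_eq not_le subsetI)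
      \<comment> \<open>A single \<open>y\<close> beyond the threshold would put a whole progression
        into the finite set \<open>?S\<close>.\<close>
      have "below (y + N * j) x" for j
      proof (induction j)
        case (Suc j)
        \<comment> \<open>All parameters other than \<open>x\<close> are set to 0, so the threshold
          is at most \<open>?b\<close>.\<close>
        have "(\<Sum>i=1..<k. ((\<lambda>_. 0)(1 := x)) i) \<le> x"
          by (simp add: sum.delta)
        then have "B * (1 + (\<Sum>i=1..<k. ((\<lambda>_. 0)(1 := x)) i)) \<le> ?b" by simp
        then have "B * (1 + (\<Sum>i=1..<k. ((\<lambda>_. 0)(1 := x)) i)) < y + N * j" using y(2) by linarith
        with per have "below (y + N * j + N) x \<longleftrightarrow> below (y + N * j) x" by fastforce
        with Suc show ?case by (simp add: algebra_simps)
      qed (simp add: y)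
      then have "range (\<lambda>j. y + N * j) \<subseteq> ?S" by auto
      moreover have "inj (\<lambda>j. y + N * j)" using N by (simp add: inj_on_def)
      ultimately show False using fin finite_subset finite_imageD infinite_UNIV_nat by metis
    qed
    moreover have "{..<f x} \<subseteq> f ` ?S"
    proof
      fix v assume v: "v \<in> {..<f x}"
      define y where "y = (LEAST y. y \<in> D \<and> f y = v)"
      obtain y' where "y' \<in> D \<and> f y' = v" using obtain_code by metis
      then have "y \<in> D \<and> f y = v" unfolding y_def by (rule LeastI)
      moreover have "\<not> (u \<in> D \<and> f u = v)" if "u < y" for u
        using that unfolding y_def by (rule not_less_Least)
      ultimately show "v \<in> f ` ?S" using v x by (intro image_eqI[of _ _ y]) (auto simp: below_def)
    qed
    then have "card {..<f x} \<le> card ?S" using fin by (meson card_image_le card_mono finite_imageI le_trans)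
    moreover have "card ?S \<le> card {..?b}" using calculation(1) by (intro card_mono) auto
    ultimately show ?thesis by simp
  qed
  then show ?thesis by blast
qed

text \<open>Along a residue class the increments are eventually constant: one value occurs
  infinitely often by linear growth, and periodicity makes it persist once it occurs late
  enough.\<close>

lemma eventually_affine:
  "\<exists>N>0. \<exists>b. \<forall>n\<in>D. b < n \<longrightarrow>
    (\<exists>m v. n \<le> m \<and> m mod N = n mod N \<and> (\<forall>j. m + N * j \<in> D \<and> f (m + N * j) = f m + v * j))"
proof -
  \<comment> \<open>The distance \<open>p\<close> is a variable, so the period can be found first
    and then substituted for \<open>p\<close>.\<close>
  define shift where "shift n p w \<longleftrightarrow> (\<exists>x. x = n + p \<and> sum_rel x n w)" for n p w
  define up where "up n p \<longleftrightarrow> (\<exists>x. x = n + p \<and> (n \<in> D \<and> x \<in> D \<and> f n \<le> f x))" for n p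
  have "definable (\<lambda>s. shift (s 0) (s 1) (s 2))"
    unfolding shift_def
    by (intro definable_Ex[where x = 3] definable_conj definable_add definable_sum_rel) simp
  from definable_uniform_period[OF this, simplified] obtain N1 where N1: "0 < N1"
    "\<forall>L. N1 dvd L \<longrightarrow> (\<forall>s. \<exists>b. \<forall>n>b. shift (n + L) (s (Suc 0)) (s 2) \<longleftrightarrow> shift n (s (Suc 0)) (s 2))"
    by blast
  have "definable (\<lambda>s. up (s 0) (s 1))"
    unfolding up_def
    by (intro definable_Ex[where x = 2] definable_conj[of "\<lambda>s. s 2 = s 0 + s 1"] definable_add
        definable_le) simp
  from definable_uniform_period[OF this, simplified] obtain N2 where N2: "0 < N2"
    "\<forall>L. N2 dvd L \<longrightarrow> (\<forall>s. \<exists>b. \<forall>n>b. up (n + L) (s (Suc 0)) \<longleftrightarrow> up n (s (Suc 0)))"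
    by blast
  from definable_uniform_period[OF definable_domain[of 0], simplified] obtain N3 where N3: "0 < N3"
    "\<forall>L. N3 dvd L \<longrightarrow> (\<exists>b. \<forall>n>b. n + L \<in> D \<longleftrightarrow> n \<in> D)"
    by auto
  define N where "N = N1 * N2 * N3"
  have N: "0 < N" "N1 dvd N" "N2 dvd N" "N3 dvd N" using N1 N2 N3 by (auto simp: N_def)
  have per_shift: "\<exists>b. \<forall>n>b. shift (n + N) N w \<longleftrightarrow> shift n N w" for w
    using N1(2)[rule_format, OF N(2), of "(\<lambda>_. w)(1 := N)"] by simp
  obtain b2 where b2: "\<And>n. b2 < n \<Longrightarrow> up (n + N) N \<longleftrightarrow> up n N"
    using N2(2)[rule_format, OF N(3), of "\<lambda>_. N"] by auto
  obtain b3 where b3: "\<And>n. b3 < n \<Longrightarrow> n + N \<in> D \<longleftrightarrow> n \<in> D"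
    using N3(2) N(4) by blast
  obtain B where B: "\<And>x. x \<in> D \<Longrightarrow> f x \<le> B * (1 + x)" using linear_bound by blast
  have "\<exists>m v. n \<le> m \<and> m mod N = n mod N \<and> (\<forall>j. m + N * j \<in> D \<and> f (m + N * j) = f m + v * j)"
    if n: "n \<in> D" "b2 + b3 < n" for n
  proof -
    have in_D: "n + N * t \<in> D" for t
    proof (induction t)
      case (Suc t)
      have "b3 < n + N * t" using n by linarith
      from b3[OF this] Suc show ?case by (simp add: algebra_simps)
    qed (simp add: n)
    have up_iff: "up (n + N * t) N \<longleftrightarrow> up n N" for t
    proof (induction t)
      case (Suc t)
      have "b2 < n + N * t" using n by linarith
      from b2[OF this] Suc show ?case by (simp add: algebra_simps)
    qed simp
    define a where "a t = f (n + N * t)" for t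
    have up_a: "up (n + N * t) N \<longleftrightarrow> a t \<le> a (Suc t)" for t
      using in_D[of t] in_D[of "Suc t"] by (simp add: up_def a_def algebra_simps)
    \<comment> \<open>By \<open>up_iff\<close> the comparison has the same outcome at every
      \<open>t\<close>, so one strict descent would give an infinite one.\<close>
    have mono: "a t \<le> a (Suc t)" for t
    proof (rule ccontr)
      assume "\<not> a t \<le> a (Suc t)"
      then have dec: "a (Suc t) < a t" for t using up_a up_iff by (meson not_le)
      have "a t + t \<le> a 0" for t
      proof (induction t)
        case (Suc t)
        then show ?case using dec[of t] by linarith
      qed simp
      from this[of "Suc (a 0)"] show False by simp
    qed
    have bound: "a t \<le> B * (1 + n) + (B * N) * t" for t
      using B[OF in_D[of t]] by (simp add: a_def algebra_simps)
    obtain v where v: "infinite {t. a (Suc t) = a t + v}"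
      using bounded_slope_imp_frequent_increment[OF mono bound] by blast
    \<comment> \<open>The increment \<open>v\<close> enters \<open>shift\<close> through a code of
      it; the threshold \<open>b\<close> depends on this code.\<close>
    obtain w where w: "w \<in> D" "f w = v" by (rule obtain_code)
    obtain b where b: "\<And>n. b < n \<Longrightarrow> shift (n + N) N w \<longleftrightarrow> shift n N w"
      using per_shift[of w] by blast
    have shift_a: "shift (n + N * t) N w \<longleftrightarrow> a (Suc t) = a t + v" for t
      using in_D[of t] in_D[of "Suc t"] w by (simp add: shift_def sum_rel_def a_def algebra_simps)
    \<comment> \<open>Infinitely many occurrences of \<open>v\<close> supply one beyond
      \<open>b\<close>, from where periodicity propagates it.\<close>
    obtain t where t: "b < t" "a (Suc t) = a t + v"
      using v by (metis (mono_tags, lifting) finite_nat_set_iff_bounded_le mem_Collect_eq not_le)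
    have step: "a (Suc (t + j)) = a (t + j) + v" for j
    proof (induction j)
      case (Suc j)
      have "t + j \<le> N * (t + j)" using N(1) by simp
      then have "b < n + N * (t + j)" using t(1) by linarith
      from b[OF this] Suc shift_a[of "t + j"] shift_a[of "Suc (t + j)"] show ?case
        by (simp add: algebra_simps)
    qed (simp add: t)
    have "a (t + j) = a t + v * j" for j
      by (induction j) (simp_all add: step)
    then have "f (n + N * t + N * j) = f (n + N * t) + v * j" for j
      unfolding a_def by (metis add.assoc distrib_left)
    moreover have "n + N * t + N * j \<in> D" for j
      using in_D[of "t + j"] by (simp add: algebra_simps)
    ultimately show ?thesis by (intro exI[of _ "n + N * t"] exI[of _ v]) simp
  qed
  with N(1) show ?thesis by blast
qed

lemma definable_graph: "definable (\<lambda>s. s 0 \<in> D \<and> f (s 0) = s 1)"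
proof -
  obtain N b where N: "0 < N" and affine: "\<And>n. n \<in> D \<Longrightarrow> b < n \<Longrightarrow>
    \<exists>m v. n \<le> m \<and> m mod N = n mod N \<and> (\<forall>j. m + N * j \<in> D \<and> f (m + N * j) = f m + v * j)"
    using eventually_affine by blast
  \<comment> \<open>A residue class either has no code above \<open>b\<close>, and then its part of
    the graph is finite, or it is finite below \<open>m\<close> and a single progression from
    \<open>m\<close> on.\<close>
  have "definable (\<lambda>s. (s 0 \<in> D \<and> s 0 mod N = r) \<and> f (s 0) = s 1)" for r
  proof (cases "\<exists>n\<in>D. b < n \<and> n mod N = r")
    case False
    then have "{n \<in> D. n mod N = r} \<subseteq> {..b}" by (auto simp: not_less[symmetric])
    then have "finite {n \<in> D. n mod N = r}" by (rule finite_subset) simp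
    from definable_finite_graph[OF this, of f] show ?thesis by simp
  next
    case True
    then obtain m v where m: "m mod N = r" "\<And>j. m + N * j \<in> D"
      "\<And>j. f (m + N * j) = f m + v * j"
      using affine by metis
    have "definable (\<lambda>s. (s 0 \<in> {n \<in> D. n mod N = r \<and> n < m} \<and> f (s 0) = s 1) \<or>
        (\<exists>j. s 0 = m + N * j \<and> s 1 = f m + v * j))"
      by (intro definable_disj definable_finite_graph definable_progression) simp
    moreover have "(x \<in> {n \<in> D. n mod N = r \<and> n < m} \<and> f x = y) \<or>
        (\<exists>j. x = m + N * j \<and> y = f m + v * j) \<longleftrightarrow> (x \<in> D \<and> x mod N = r) \<and> f x = y" for x y
    proof (cases "x < m")
      case False
      then have "\<exists>j. x = m + N * j" if "x mod N = r"
        using that m(1) by (metis dvdE le_add_diff_inverse mod_eq_dvd_iff_nat not_le)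
      then show ?thesis using m False by auto
    qed (use m in auto)
    ultimately show ?thesis by simp
  qed
  then have "definable (\<lambda>s. \<exists>r\<in>{..<N}. (s 0 \<in> D \<and> s 0 mod N = r) \<and> f (s 0) = s 1)"
    by (intro definable_finite_Bex) auto
  then show ?thesis using N by simp
qed

end

section \<open>Application to interpretations\<close>

lemma definable_holds:
  assumes "free_vars \<phi> \<subseteq> {..<k}"
  shows "definable (\<lambda>s. holds nat_struct \<phi> (map s [0..<k]))"
  unfolding definable_def holds_def
  by (rule exI[of _ \<phi>], intro allI sat_cong) (use assms in auto)

text \<open>The only additive bijection of the naturals is the identity: it multiplies by its value
  at 1, and it attains 1. This identifies the otherwise unknown bijection of the trivial
  interpretation.\<close>

lemma interprets_trivial_class:
  assumes "interprets_via nat_struct nat_struct trivial_translation h"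
  shows "h (interp_class nat_struct trivial_translation [n]) = n"
proof -
  let ?D = "interp_dom nat_struct trivial_translation"
  let ?k = "\<lambda>n. h (interp_class nat_struct trivial_translation [n])"
  have D: "?D = range (\<lambda>n. [n])"
    by (auto simp: interp_dom_def trivial_translation_def holds_def nat_struct_def length_Suc_conv)
  have "?k (a + b) = ?k a + ?k b" for a b
  proof -
    have "holds nat_struct (tr_add trivial_translation) ([a + b] @ [a] @ [b])"
      by (simp add: holds_def trivial_translation_def nat_struct_def)
    then show ?thesis
      using assms unfolding interprets_via_def D by (simp add: nat_struct_def)
  qed
  note add = this
  have linear: "?k n = n * ?k 1" for n
  proof (induction n)
    case 0
    show ?case using add[of 0 0] by simp
  next
    case (Suc n)
    then show ?case using add[of 1 n] by simp
  qed
  have "1 \<in> h ` (?D // interp_rel nat_struct trivial_translation)"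
    using assms by (auto simp: interprets_via_def bij_betw_def nat_struct_def)
  then obtain m where "?k m = 1" by (auto simp: quotient_def D)
  with linear have "?k 1 = 1" by (metis nat_mult_eq_1_iff)
  with linear[of n] show ?thesis by simp
qed

theorem theorem1:
  fixes A :: "'a plus_struct" and \<iota> :: translation
  assumes "model_PrA A"
    and "tr_dim \<iota> = 1"
    and "is_interpretation A nat_struct \<iota>"
  shows "isomorphic A nat_struct \<and>
         definably_isomorphic nat_struct nat_struct \<iota> trivial_translation"
proof
  obtain h where h: "interprets_via A nat_struct \<iota> h"
    using assms(3) by (auto simp: is_interpretation_def)
  \<comment> \<open>Domain elements are lists of length one; \<open>D\<close> and \<open>f\<close>
    restate the interpretation for plain numbers.\<close>
  define D where "D = {n. [n] \<in> interp_dom nat_struct \<iota>}"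
  define f where "f n = h (interp_class nat_struct \<iota> [n])" for n
  have dom: "interp_dom nat_struct \<iota> = (\<lambda>n. [n]) ` D"
    using assms(2) by (auto simp: D_def interp_dom_def length_Suc_conv)
  have "h ` (interp_dom nat_struct \<iota> // interp_rel nat_struct \<iota>) = elems A"
    using h by (simp add: interprets_via_def bij_betw_def)
  moreover have "interp_dom nat_struct \<iota> // interp_rel nat_struct \<iota> =
      (\<lambda>n. interp_class nat_struct \<iota> [n]) ` D"
    by (auto simp: quotient_def dom)
  ultimately have im: "f ` D = elems A"
    by (simp add: f_def image_image)
  have trans: "is_translation \<iota>" using h by (simp add: interprets_via_def)
  have sum_iff: "f a = add A (f b) (f c) \<longleftrightarrow> holds nat_struct (tr_add \<iota>) [a, b, c]"
    if "a \<in> D" "b \<in> D" "c \<in> D" for a b c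
    using h that unfolding interprets_via_def f_def D_def by simp
  have def_dom: "definable (\<lambda>s. s 0 \<in> D)"
    using definable_holds[of "tr_dom \<iota>" 1] trans assms(2)
    by (simp add: D_def interp_dom_def is_translation_def nat_struct_def)
  have def_dom': "definable (\<lambda>s. s i \<in> D)" for i
    using definable_rename2[of "\<lambda>x _. x \<in> D"] def_dom by simp
  have "definable (\<lambda>s. holds nat_struct (tr_add \<iota>) [s 0, s 1, s 2])"
    using definable_holds[of "tr_add \<iota>" 3] trans assms(2)
    by (simp add: is_translation_def upt_rec numeral_2_eq_2)
  then have "definable (\<lambda>s. s 0 \<in> D \<and> s 1 \<in> D \<and> s 2 \<in> D \<and>
      holds nat_struct (tr_add \<iota>) [s 0, s 1, s 2])"
    by (intro definable_conj def_dom')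
  then have def_add: "definable (\<lambda>s. s 0 \<in> D \<and> s 1 \<in> D \<and> s 2 \<in> D \<and>
      f (s 0) = add A (f (s 1)) (f (s 2)))"
    by (simp add: sum_iff cong: conj_cong)
  show iso: "isomorphic A nat_struct"
    using interpreted_model_isomorphic[OF assms(1) im def_add] .
  then obtain F :: "'a \<Rightarrow> nat" where F: "bij_betw F (elems A) UNIV"
    "\<And>x y. x \<in> elems A \<Longrightarrow> y \<in> elems A \<Longrightarrow> F (add A x y) = F x + F y"
    by (auto simp: isomorphic_def nat_struct_def)
  have F_eq: "F x = F y \<longleftrightarrow> x = y" if "x \<in> elems A" "y \<in> elems A" for x y
    using F(1) that by (auto simp: bij_betw_def inj_on_def)
  have f_in: "f n \<in> elems A" if "n \<in> D" for n using im that by blast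
  have F_sum: "F (f a) = F (f b) + F (f c) \<longleftrightarrow> f a = add A (f b) (f c)"
    if "a \<in> D" "b \<in> D" "c \<in> D" for a b c
    using F(2)[of "f b" "f c"] F_eq[of "f a" "add A (f b) (f c)"] f_in that
      model_PrA_closed[OF assms(1)] by metis
  \<comment> \<open>Composing with the isomorphism \<open>F\<close> turns elements of
    \<open>A\<close> into numbers, so the graph of the code map becomes a definable relation; its
    formula \<open>I\<close> is the required isomorphism.\<close>
  interpret nat_presentation D "F \<circ> f"
  proof
    show "(F \<circ> f) ` D = UNIV"
      using im F(1) by (simp only: image_comp[symmetric] bij_betw_def)
    show "definable (\<lambda>s. s 0 \<in> D \<and> s 1 \<in> D \<and> s 2 \<in> D \<and>
        (F \<circ> f) (s 0) = (F \<circ> f) (s 1) + (F \<circ> f) (s 2))"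
      using def_add by (simp add: F_sum cong: conj_cong)
  qed
  obtain I where I: "free_vars I \<subseteq> {..<2}"
    "\<And>s. sat nat_struct s I \<longleftrightarrow> s 0 \<in> D \<and> F (f (s 0)) = s 1"
    using definable_obtain_formula[of "\<lambda>x y. x \<in> D \<and> F (f x) = y"] definable_graph by auto
  obtain k where k: "interprets_via nat_struct nat_struct trivial_translation k"
    using trivial_interpretation by (auto simp: is_interpretation_def)
  \<comment> \<open>The trivial translation interprets \<open>nat_struct\<close>, so
    \<open>\<iota>\<close> has to be read as an interpretation of \<open>nat_struct\<close> too, by
    transporting \<open>h\<close> along \<open>F\<close>.\<close>
  have via: "interprets_via nat_struct nat_struct \<iota> (F \<circ> h)"
    unfolding interprets_via_def
  proof (intro conjI)
    show "bij_betw (F \<circ> h) (interp_dom nat_struct \<iota> // interp_rel nat_struct \<iota>) (elems nat_struct)"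
      using h F(1) by (auto simp: interprets_via_def nat_struct_def intro: bij_betw_trans)
    show "\<forall>b1\<in>interp_dom nat_struct \<iota>. \<forall>b2\<in>interp_dom nat_struct \<iota>.
        (F \<circ> h) (interp_class nat_struct \<iota> b1) = (F \<circ> h) (interp_class nat_struct \<iota> b2) \<longleftrightarrow>
        holds nat_struct (tr_eq \<iota>) (b1 @ b2)"
    proof -
      have "h (interp_class nat_struct \<iota> b1) = h (interp_class nat_struct \<iota> b2) \<longleftrightarrow>
          holds nat_struct (tr_eq \<iota>) (b1 @ b2)"
        if "b1 \<in> interp_dom nat_struct \<iota>" "b2 \<in> interp_dom nat_struct \<iota>" for b1 b2
        using h that unfolding interprets_via_def by blast
      then show ?thesis using F_eq f_in unfolding dom f_def by auto
    qed
    show "\<forall>b0\<in>interp_dom nat_struct \<iota>. \<forall>b1\<in>interp_dom nat_struct \<iota>.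
        \<forall>b2\<in>interp_dom nat_struct \<iota>.
        (F \<circ> h) (interp_class nat_struct \<iota> b0) =
          add nat_struct ((F \<circ> h) (interp_class nat_struct \<iota> b1))
            ((F \<circ> h) (interp_class nat_struct \<iota> b2)) \<longleftrightarrow>
        holds nat_struct (tr_add \<iota>) (b0 @ b1 @ b2)"
      using F_sum sum_iff unfolding dom f_def by (auto simp: nat_struct_def)
  qed (use h in \<open>auto simp: interprets_via_def\<close>)
  have dom_trivial: "interp_dom nat_struct trivial_translation = range (\<lambda>n. [n])"
    by (auto simp: interp_dom_def trivial_translation_def holds_def nat_struct_def length_Suc_conv)
  show "definably_isomorphic nat_struct nat_struct \<iota> trivial_translation"
    unfolding definably_isomorphic_def
  proof (intro exI conjI)
    show "free_vars I \<subseteq> {..<tr_dim \<iota> + tr_dim trivial_translation}"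
      using I(1) assms(2) by (simp add: trivial_translation_def numeral_2_eq_2)
    show "\<forall>b\<in>interp_dom nat_struct \<iota>. \<forall>c\<in>interp_dom nat_struct trivial_translation.
        (F \<circ> h) (interp_class nat_struct \<iota> b) = k (interp_class nat_struct trivial_translation c) \<longleftrightarrow>
        holds nat_struct I (b @ c)"
      by (auto simp: dom dom_trivial holds_def I(2) interprets_trivial_class[OF k] f_def[symmetric])
  qed (fact via k)+
qed

end
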